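(* $\mathcal{M}(\Delta^3)\simeq\bigvee^{99}S^4$.
   Context: All simplicial complexes are finite abstract simplicial complexes; simplices are nonempty. $\Delta^3$ is the simplicial complex of all nonempty subsets of a $4$-element vertex set. The Hasse diagram $\mathcal{H}(K)$ of $K$ is the directed graph whose vertices are the simplices of $K$, with an edge $\sigma\to\tau$ whenever $\sigma\subsetneq\tau$ and $\dim\tau=\dim\sigma+1$. A matching on $\mathcal{H}(K)$ is a set $W$ of edges of $\mathcal{H}(K)$, no two sharing a vertex. $W$ is acyclic if the directed graph obtained from $\mathcal{H}(K)$ by reversing every edge in $W$ has no directed cycle. The complex of discrete Morse matchings $\mathcal{M}(K)$ is the simplicial complex whose vertices are the edges of $\mathcal{H}(K)$ and whose simplices are the nonempty acyclic matchings on $\mathcal{H}(K)$. *)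

theory Defs
  imports "HOL-Analysis.Analysis"
begin

text \<open>Simplicial complexes are represented as sets of (finite, nonempty) vertex sets.
  The dimension of a simplex is its cardinality minus one.\<close>

definition hasse_edges :: "'a set set \<Rightarrow> ('a set \<times> 'a set) set" where
  "hasse_edges K = {(\<sigma>, \<tau>). \<sigma> \<in> K \<and> \<tau> \<in> K \<and> \<sigma> \<subset> \<tau> \<and> card \<tau> = Suc (card \<sigma>)}"

definition is_matching :: "'a set set \<Rightarrow> ('a set \<times> 'a set) set \<Rightarrow> bool" where
  "is_matching K W \<longleftrightarrow> W \<subseteq> hasse_edges K \<and>
     (\<forall>e\<in>W. \<forall>e'\<in>W. e \<noteq> e' \<longrightarrow> {fst e, snd e} \<inter> {fst e', snd e'} = {})"

definition acyclic_matching :: "'a set set \<Rightarrow> ('a set \<times> 'a set) set \<Rightarrow> bool" where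
  "acyclic_matching K W \<longleftrightarrow> is_matching K W \<and> acyclic ((hasse_edges K - W) \<union> W\<inverse>)"

definition morse_complex :: "'a set set \<Rightarrow> ('a set \<times> 'a set) set set" where
  "morse_complex K = {W. W \<noteq> {} \<and> acyclic_matching K W}"

definition Delta3 :: "nat set set" where
  "Delta3 = {\<sigma>. \<sigma> \<subseteq> {0..3} \<and> \<sigma> \<noteq> {}}"

definition geom_real_set :: "'v set set \<Rightarrow> ('v \<Rightarrow> real) set" where
  "geom_real_set K = {f. (\<forall>v. f v \<ge> 0) \<and> (\<exists>\<sigma>\<in>K. {v. f v \<noteq> 0} \<subseteq> \<sigma> \<and> sum f \<sigma> = 1)}"

definition geom_real :: "'v set set \<Rightarrow> ('v \<Rightarrow> real) topology" where
  "geom_real K = subtopology (powertop_real UNIV) (geom_real_set K)"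

text \<open>Wedge of n copies of the d-sphere: the k-th sphere is the unit d-sphere in the
  coordinates (k,0),...,(k,d) centred at the unit vector e_(k,0); all spheres meet
  exactly at the origin.\<close>
definition wedge_spheres_set :: "nat \<Rightarrow> nat \<Rightarrow> (nat \<times> nat \<Rightarrow> real) set" where
  "wedge_spheres_set n d = {x. \<exists>k<n. (\<forall>j i. (j \<noteq> k \<or> i > d) \<longrightarrow> x (j, i) = 0) \<and>
      (\<Sum>i\<le>d. (x (k, i) - (if i = 0 then 1 else 0))\<^sup>2) = 1}"

definition wedge_spheres :: "nat \<Rightarrow> nat \<Rightarrow> (nat \<times> nat \<Rightarrow> real) topology" where
  "wedge_spheres n d = subtopology (powertop_real UNIV) (wedge_spheres_set n d)"

end

(* The Hasse diagram of the 3-simplex has 28 edges, and a set of edges is an acyclic matching iff no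
   two of them share a simplex and it contains no closed V-path; by dimension, a closed V-path runs
   through vertices and edges or through edges and triangles, and it has length 3 or 4. The faces of
   the complex are therefore the subsets of a 28-element set that avoid finitely many small sets.

   A matching tree (a decision tree on the vertices whose leaves match a face W with the symmetric
   difference of W and {u}) yields an acyclic matching on these faces, the empty face included, whose
   only critical faces are 99 faces of dimension 4. Removing the matched pairs above dimension 4
   first, then the critical faces, and then the remaining pairs shows that the complex collapses to
   the union of a collapsible complex and 99 facets of dimension 4. Contracting the collapsible part,
   by an explicit homotopy extension, identifies the homotopy type as the wedge. *)

theory Submission
  imports Defs
begin

section \<open>Elementary collapses\<close>

text \<open>All critical faces have the same dimension, and this shapes the argument: higher pairs
  can be removed before them and lower pairs after them, so elementary collapses and a single
  quotient by a contractible subcomplex suffice, with no control of attaching maps. Acyclicity of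
  the matching is never stated as a condition on closed paths; the tree itself supplies a collapsing
  order, because the faces containing a branching vertex form an upward closed part. The number 99
  is forced: with the empty face matched and every critical face of even dimension, it equals the
  reduced Euler characteristic. Since the wedge is a concrete union of round spheres, the quotient
  map has to be a formula. It is rational in the barycentric coordinates and their minimum over each
  facet, and vanishes where that minimum does, so it is continuous across the boundaries of the
  facets. No closed V-path runs through triangles and the tetrahedron: there is only one
  tetrahedron, so the edge entering it and the matched edge leaving it would meet the requirements
  of different triangles matched to the same simplex.\<close>

definition simplicial_complex :: "'v set set \<Rightarrow> bool" where
  "simplicial_complex K \<longleftrightarrow> (\<forall>\<sigma>\<in>K. finite \<sigma> \<and> \<sigma> \<noteq> {} \<and> (\<forall>\<tau>. \<tau> \<subseteq> \<sigma> \<longrightarrow> \<tau> \<noteq> {} \<longrightarrow> \<tau> \<in> K))"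

lemma simplicial_complexD:
  assumes "simplicial_complex K" "\<sigma> \<in> K"
  shows "finite \<sigma>" "\<sigma> \<noteq> {}" "\<And>\<tau>. \<tau> \<subseteq> \<sigma> \<Longrightarrow> \<tau> \<noteq> {} \<Longrightarrow> \<tau> \<in> K"
  using assms unfolding simplicial_complex_def by blast+

abbreviation supp :: "('v \<Rightarrow> real) \<Rightarrow> 'v set" where
  "supp x \<equiv> {v. x v \<noteq> 0}"

lemma geom_real_eq_top_of_set: "geom_real K = top_of_set (geom_real_set K)"
  by (simp add: geom_real_def euclidean_product_topology)

lemma wedge_spheres_eq_top_of_set: "wedge_spheres n d = top_of_set (wedge_spheres_set n d)"
  by (simp add: wedge_spheres_def euclidean_product_topology)

lemma geom_real_setI:
  assumes "\<And>v. x v \<ge> 0" "\<sigma> \<in> K" "supp x \<subseteq> \<sigma>" "sum x \<sigma> = 1"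
  shows "x \<in> geom_real_set K"
  unfolding geom_real_set_def mem_Collect_eq using assms by blast

lemma geom_real_setD:
  assumes "simplicial_complex K" "x \<in> geom_real_set K"
  shows "x v \<ge> 0" "supp x \<in> K" "sum x (supp x) = 1"
proof -
  obtain \<sigma> where \<sigma>: "\<forall>v. x v \<ge> 0" "\<sigma> \<in> K" "supp x \<subseteq> \<sigma>" "sum x \<sigma> = 1"
    using assms(2) by (auto simp: geom_real_set_def)
  have fin: "finite \<sigma>" using simplicial_complexD(1)[OF assms(1) \<sigma>(2)] .
  show "x v \<ge> 0" using \<sigma> by blast
  have "sum x (supp x) = sum x \<sigma>"
    by (rule sum.mono_neutral_left[OF fin \<sigma>(3)]) simp
  then show s: "sum x (supp x) = 1" using \<sigma>(4) by (rule trans)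
  have "supp x \<noteq> {}"
  proof
    assume "supp x = {}"
    with s have "sum x {} = 1" by (simp only:)
    then show False by simp
  qed
  then show "supp x \<in> K" using simplicial_complexD(3)[OF assms(1) \<sigma>(2,3)] by blast
qed

lemma sum_eq_1:
  assumes "simplicial_complex K" "x \<in> geom_real_set K" "supp x \<subseteq> \<sigma>" "finite \<sigma>"
  shows "sum x \<sigma> = 1"
proof -
  have "sum x (supp x) = sum x \<sigma>"
    by (rule sum.mono_neutral_left[OF assms(4,3)]) simp
  from trans[OF this[symmetric] geom_real_setD(3)[OF assms(1,2)]] show ?thesis .
qed

lemma continuous_on_coord:
  fixes g :: "'a::topological_space \<Rightarrow> 'b \<Rightarrow> 'c::topological_space"
  assumes "continuous_on S g"
  shows "continuous_on S (\<lambda>x. g x i)"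
  by (rule continuous_on_product_then_coordinatewise[OF assms])

lemma continuous_on_Min:
  fixes g :: "'a::topological_space \<Rightarrow> 'b \<Rightarrow> real"
  assumes "finite A" "A \<noteq> {}" "continuous_on S g"
  shows "continuous_on S (\<lambda>x. Min (g x ` A))"
  using assms
proof (induction A rule: finite_ne_induct)
  case (singleton a)
  then show ?case using continuous_on_coord[of S g a] by simp
next
  case (insert a A)
  have "(\<lambda>x. Min (g x ` insert a A)) = (\<lambda>x. min (g x a) (Min (g x ` A)))"
    using insert by auto
  then show ?case using continuous_on_min[OF continuous_on_coord[OF insert.prems, of a] insert.IH[OF insert.prems]] by (simp only:)
qed

lemma homotopic_canonI:
  fixes h :: "real \<times> 'a::topological_space \<Rightarrow> 'b::topological_space"
  assumes "continuous_on ({0..1} \<times> S) h" "\<And>t x. t \<in> {0..1} \<Longrightarrow> x \<in> S \<Longrightarrow> h (t, x) \<in> T"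
    "\<And>x. x \<in> S \<Longrightarrow> h (0, x) = f x" "\<And>x. x \<in> S \<Longrightarrow> h (1, x) = g x"
  shows "homotopic_with_canon (\<lambda>x. True) S T f g"
proof -
  have *: "prod_topology (top_of_set {0..1::real}) (top_of_set S) = top_of_set ({0..1} \<times> S)"
    by (simp flip: subtopology_Times)
  show ?thesis
    by (subst homotopic_with) (use assms * in \<open>auto intro!: exI[of _ h]\<close>)
qed

text \<open>The free face is pushed in linearly: weight moves at equal speed from all vertices of
  \<open>A\<close> to \<open>v\<close> until the smallest coordinate on \<open>A\<close> reaches 0.
  The support has then lost a vertex of \<open>A\<close>, so it is neither \<open>A\<close> nor
  \<open>insert v A\<close>. Since the minimum over \<open>A\<close> is 0 wherever the support does
  not contain \<open>A\<close>, one formula covers all of \<open>X\<close> and fixes the smaller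
  complex.\<close>

lemma homotopy_equivalent_elementary_collapse:
  assumes X: "simplicial_complex X" and A: "A \<in> X" "v \<notin> A" "insert v A \<in> X"
    and free: "\<And>B. B \<in> X \<Longrightarrow> A \<subseteq> B \<Longrightarrow> B = A \<or> B = insert v A"
  shows "geom_real X homotopy_equivalent_space geom_real (X - {A, insert v A})"
proof -
  define Y where "Y = X - {A, insert v A}"
  note fA = simplicial_complexD(1,2)[OF X A(1)]
  have Y: "simplicial_complex Y"
    unfolding simplicial_complex_def
  proof (intro ballI conjI allI impI)
    fix \<sigma> assume \<sigma>: "\<sigma> \<in> Y"
    then have \<sigma>X: "\<sigma> \<in> X" and "\<sigma> \<noteq> A" "\<sigma> \<noteq> insert v A" by (auto simp: Y_def)
    then have nA: "\<not> A \<subseteq> \<sigma>" using free by blast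
    show "finite \<sigma>" "\<sigma> \<noteq> {}" using simplicial_complexD(1,2)[OF X \<sigma>X] by auto
    fix \<tau> assume "\<tau> \<subseteq> \<sigma>" "\<tau> \<noteq> {}"
    then show "\<tau> \<in> Y" using simplicial_complexD(3)[OF X \<sigma>X] nA by (auto simp: Y_def)
  qed
  define m where "m x = Min (x ` A)" for x :: "'a \<Rightarrow> real"
  \<comment> \<open>The entries of \<open>c\<close> over \<open>insert v A\<close> add up to 0, so
    moving along \<open>c\<close> keeps the sum of the coordinates equal to 1.\<close>
  define c where "c w = (if w = v then real (card A) else if w \<in> A then - 1 else 0)" for w
  define r where "r s x = (\<lambda>w. x w + s * m x * c w)"
    for s :: real and x :: "'a \<Rightarrow> real"
  have mcont: "continuous_on S (\<lambda>z. m (g z))" if "continuous_on S g" for S and g :: "real \<times> ('a \<Rightarrow> real) \<Rightarrow> 'a \<Rightarrow> real"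
    unfolding m_def using fA that by (rule continuous_on_Min)
  have m_le: "m x \<le> x a" if "a \<in> A" for a x using that fA by (auto simp: m_def)
  have m_att: "\<exists>a\<in>A. x a = m x" for x
  proof -
    have "m x \<in> x ` A" unfolding m_def using fA by (intro Min_in) auto
    then show ?thesis by auto
  qed
  have m0: "m x = 0" if x: "x \<in> geom_real_set X" and nsub: "\<not> A \<subseteq> supp x" for x
  proof -
    obtain a where "a \<in> A" "x a = 0" using nsub by blast
    then have "m x \<le> 0" using m_le by metis
    then show ?thesis using m_att[of x] geom_real_setD(1)[OF X x] by (metis order_antisym)
  qed
  have r_in: "r s x \<in> geom_real_set X \<and> (s = 1 \<longrightarrow> r s x \<in> geom_real_set Y)"
    if s: "s \<in> {0..1}" and x: "x \<in> geom_real_set X" for s x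
  proof (cases "A \<subseteq> supp x")
    case False
    have "r s x = x" using m0[OF x False] by (auto simp: r_def)
    moreover have "supp x \<in> Y" using geom_real_setD(2)[OF X x] False by (auto simp: Y_def)
    ultimately show ?thesis
      using x geom_real_setD[OF X x] by (auto intro!: geom_real_setI[of x "supp x" Y])
  next
    case True
    have xn: "x w \<ge> 0" for w using geom_real_setD(1)[OF X x] .
    have mn: "m x \<ge> 0" using m_att[of x] xn by metis
    have sup: "supp x \<subseteq> insert v A"
      using free[OF geom_real_setD(2)[OF X x] True] by auto
    have rn: "r s x w \<ge> 0" for w
    proof -
      have "s * m x \<le> 1 * m x" using s mn by (intro mult_right_mono) auto
      then show ?thesis using m_le[of w x] A(2) xn[of w] s mn by (auto simp: r_def c_def)
    qed
    have rsup: "supp (r s x) \<subseteq> insert v A" using sup by (auto simp: r_def c_def)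
    have fins: "finite (insert v A)" using fA by auto
    have "sum c A = (\<Sum>w\<in>A. - 1)" using A(2) by (intro sum.cong) (auto simp: c_def)
    then have "sum c (insert v A) = 0" using A(2) fA by (simp add: c_def)
    then have rsum: "sum (r s x) (insert v A) = 1"
      using sum_eq_1[OF X x sup fins] by (simp add: r_def sum.distrib flip: sum_distrib_left)
    have rX: "r s x \<in> geom_real_set X"
      using geom_real_setI[OF rn A(3) rsup rsum] .
    moreover have "r s x \<in> geom_real_set Y" if "s = 1"
    proof -
      obtain a where a: "a \<in> A" "x a = m x" using m_att by blast
      then have "r s x a = 0" using A(2) that by (auto simp: r_def c_def)
      then have "\<not> A \<subseteq> supp (r s x)" using a by auto
      then have "supp (r s x) \<in> Y" using geom_real_setD(2)[OF X rX] by (auto simp: Y_def)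
      then show ?thesis using geom_real_setD[OF X rX] rn by (auto intro!: geom_real_setI[of _ "supp (r s x)" Y])
    qed
    ultimately show ?thesis by blast
  qed
  have rY: "r s x = x" if "x \<in> geom_real_set Y" for s x
  proof -
    have xX: "x \<in> geom_real_set X" using that by (auto simp: geom_real_set_def Y_def)
    have "supp x \<in> Y" using geom_real_setD[OF Y that] by blast
    then have "\<not> A \<subseteq> supp x" using free by (auto simp: Y_def)
    then show ?thesis using m0[OF xX] by (auto simp: r_def)
  qed
  have YX: "geom_real_set Y \<subseteq> geom_real_set X" by (auto simp: geom_real_set_def Y_def)
  have cont: "continuous_on S (\<lambda>z. r (fst z) (snd z))" for S
  proof (rule continuous_on_coordinatewise_then_product)
    fix w
    note cts = continuous_on_coord[OF continuous_on_snd[OF continuous_on_id], of S w]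
      mcont[OF continuous_on_snd[OF continuous_on_id], of S]
    show "continuous_on S (\<lambda>z. r (fst z) (snd z) w)"
      unfolding r_def
      by (intro continuous_on_add continuous_on_mult continuous_on_const cts continuous_on_fst continuous_on_id)
  qed
  have cont1: "continuous_on S (r 1)" for S
  proof -
    have "continuous_on ((\<lambda>x. (1, x)) ` S) (\<lambda>z. r (fst z) (snd z))" by (rule cont)
    moreover have "continuous_on S (\<lambda>x. (1::real, x))"
      by (intro continuous_on_Pair continuous_on_const continuous_on_id)
    ultimately show ?thesis
      using continuous_on_compose[of S "\<lambda>x. (1, x)" "\<lambda>z. r (fst z) (snd z)"] by (simp add: o_def)
  qed
  have "homotopic_with_canon (\<lambda>x. True) (geom_real_set X) (geom_real_set X) id (r 1)"
    by (rule homotopic_canonI[where h = "\<lambda>z. r (fst z) (snd z)"]) (use cont r_in in \<open>auto simp: r_def\<close>)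
  moreover have "retraction_maps (geom_real X) (geom_real Y) (r 1) id"
    unfolding retraction_maps_def geom_real_eq_top_of_set
    using cont1[of "geom_real_set X"] r_in[of 1] rY[of _ 1] YX by (simp add: continuous_on_id Pi_iff subset_iff)
  ultimately show ?thesis
    unfolding Y_def[symmetric]
    using deformation_retract_imp_homotopy_equivalent_space[of "geom_real X" "r 1" "geom_real Y"]
    by (simp add: geom_real_eq_top_of_set homotopic_with_symD)
qed

lemma simplicial_complex_diff:
  assumes X: "simplicial_complex X" and up: "\<And>A B. A \<in> R \<Longrightarrow> B \<in> X \<Longrightarrow> A \<subseteq> B \<Longrightarrow> B \<in> R"
  shows "simplicial_complex (X - R)"
  unfolding simplicial_complex_def
proof (intro ballI conjI allI impI)
  fix \<sigma> assume "\<sigma> \<in> X - R"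
  then have \<sigma>: "\<sigma> \<in> X" "\<sigma> \<notin> R" by auto
  show "finite \<sigma>" "\<sigma> \<noteq> {}" using simplicial_complexD(1,2)[OF X \<sigma>(1)] by auto
  fix \<tau> assume \<tau>: "\<tau> \<subseteq> \<sigma>" "\<tau> \<noteq> {}"
  then have "\<tau> \<in> X" using simplicial_complexD(3)[OF X \<sigma>(1)] by blast
  moreover have "\<tau> \<notin> R" using up[OF _ \<sigma>(1) \<tau>(1)] \<sigma>(2) by blast
  ultimately show "\<tau> \<in> X - R" by blast
qed

section \<open>Collapses along matching trees\<close>

definition toggle :: "'v \<Rightarrow> 'v set \<Rightarrow> 'v set" where
  "toggle u W = (if u \<in> W then W - {u} else insert u W)"

text \<open>A largest face \<open>W\<close> of \<open>R\<close> contains \<open>u\<close>, since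
  otherwise toggling would give a larger one. Then \<open>W - {u}\<close> is a free face: anything
  properly above it lies in \<open>R\<close>, has the size of \<open>W\<close>, hence contains
  \<open>u\<close> and equals \<open>W\<close>. Removing this pair leaves a smaller instance of the
  same situation.\<close>

lemma collapse_toggle:
  assumes "simplicial_complex X" "finite R" "R \<subseteq> X"
    and "\<And>A B. A \<in> R \<Longrightarrow> B \<in> X \<Longrightarrow> A \<subseteq> B \<Longrightarrow> B \<in> R"
    and "\<And>W. W \<in> R \<Longrightarrow> toggle u W \<in> R"
  shows "geom_real X homotopy_equivalent_space geom_real (X - R)"
  using assms
proof (induction "card R" arbitrary: X R rule: less_induct)
  case less
  note X = less.prems(1) and fin = less.prems(2) and sub = less.prems(3)
    and up = less.prems(4) and tog = less.prems(5)
  show ?case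
  proof (cases "R = {}")
    case True
    then show ?thesis by (simp add: homotopy_equivalent_space_refl)
  next
    case False
    have finW: "finite W" if "W \<in> R" for W using simplicial_complexD(1)[OF X] sub that by blast
    define k where "k = Max (card ` R)"
    have "k \<in> card ` R" unfolding k_def using fin False by (intro Max_in) auto
    then obtain W where W: "W \<in> R" "k = card W" by blast
    have mx: "card Z \<le> card W" if "Z \<in> R" for Z
      unfolding W(2)[symmetric] k_def using fin that by (intro Max_ge) auto
    have ins: "u \<in> Z" if "Z \<in> R" "card W \<le> card Z" for Z
    proof (rule ccontr)
      assume "u \<notin> Z"
      then have "insert u Z \<in> R" using tog[OF that(1)] by (simp add: toggle_def)
      then show False using mx[of "insert u Z"] \<open>u \<notin> Z\<close> finW[OF that(1)] that(2) by simp
    qed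
    define A where "A = W - {u}"
    have uW: "u \<in> W" using ins[OF W(1)] by simp
    have AR: "A \<in> R" using tog[OF W(1)] uW by (simp add: toggle_def A_def)
    have WA: "insert u A = W" "u \<notin> A" using uW by (auto simp: A_def)
    have cW: "card W = Suc (card A)" using WA finW[OF AR] by (metis card_insert_disjoint)
    have free: "B = A \<or> B = insert u A" if "B \<in> X" "A \<subseteq> B" for B
    proof (cases "B = A")
      case False
      have BR: "B \<in> R" using up[OF AR that] .
      have "card A < card B" using False that finW[OF BR] by (simp add: psubset_card_mono psubset_eq)
      then have "u \<in> B" "card B = card W" using ins[OF BR] mx[OF BR] cW by auto
      then have "insert u A \<subseteq> B" "card (insert u A) = card B" using that(2) WA(1) by auto
      then show ?thesis using card_subset_eq[OF finW[OF BR]] by metis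
    qed simp
    have AX: "A \<in> X" "insert u A \<in> X" using AR W(1) WA sub by auto
    have 1: "geom_real X homotopy_equivalent_space geom_real (X - {A, W})"
      using homotopy_equivalent_elementary_collapse[OF X AX(1) WA(2) AX(2) free] WA by simp
    have up1: "B \<in> {A, W}" if "Z \<in> {A, W}" "B \<in> X" "Z \<subseteq> B" for Z B
      using that free[of B] WA by blast
    have eq: "X - {A, W} - (R - {A, W}) = X - R" using AR W by blast
    have "geom_real (X - {A, W}) homotopy_equivalent_space geom_real (X - {A, W} - (R - {A, W}))"
    proof (rule less.hyps)
      show "card (R - {A, W}) < card R"
        using fin W by (intro psubset_card_mono) auto
      show "simplicial_complex (X - {A, W})" by (rule simplicial_complex_diff[OF X]) (rule up1)
      show "finite (R - {A, W})" using fin by simp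
      show "R - {A, W} \<subseteq> X - {A, W}" using sub by blast
      show "B \<in> R - {A, W}" if "Z \<in> R - {A, W}" "B \<in> X - {A, W}" "Z \<subseteq> B" for Z B
        using that up by blast
      show "toggle u Z \<in> R - {A, W}" if Z: "Z \<in> R - {A, W}" for Z
      proof -
        have "toggle u (toggle u Z) = Z" by (auto simp: toggle_def)
        moreover have "toggle u A = W" "toggle u W = A" using WA by (auto simp: toggle_def)
        ultimately have "toggle u Z \<noteq> A" "toggle u Z \<noteq> W" using Z by (metis Diff_iff insert_iff)+
        then show ?thesis using tog Z by blast
      qed
    qed
    then show ?thesis using 1 eq by (metis homotopy_eqv_trans)
  qed
qed

text \<open>A tree describes a matching on a family of faces. Branch v s t treats the faces containing v by s
  and the others by t; Excluded v t records that no face of the family contains v; Cone u matches W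
  with toggle u W; Critical is used for a family with a single face, left unmatched.\<close>
datatype matching_tree = Branch nat matching_tree matching_tree | Excluded nat matching_tree | Cone nat | Critical

fun partner :: "matching_tree \<Rightarrow> nat set \<Rightarrow> nat option" where
  "partner (Branch v s t) W = (if v \<in> W then partner s W else partner t W)"
| "partner (Excluded v t) W = partner t W"
| "partner (Cone u) W = Some u"
| "partner Critical W = None"

fun apexes :: "matching_tree \<Rightarrow> nat set" where
  "apexes (Branch v s t) = apexes s \<union> apexes t"
| "apexes (Excluded v t) = apexes t"
| "apexes (Cone u) = {u}"
| "apexes Critical = {}"

text \<open>A vertex used for branching must not be toggled below that branching. A face and its
  partner then take the same path through the tree, which makes the matching well defined.\<close>

fun branch_once :: "matching_tree \<Rightarrow> bool" where
  "branch_once (Branch v s t) \<longleftrightarrow> v \<notin> apexes s \<and> v \<notin> apexes t \<and> branch_once s \<and> branch_once t"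
| "branch_once (Excluded v t) \<longleftrightarrow> branch_once t"
| "branch_once (Cone u) \<longleftrightarrow> True"
| "branch_once Critical \<longleftrightarrow> True"

lemma partner_in_apexes: "partner T W = Some u \<Longrightarrow> u \<in> apexes T"
  by (induction T) (auto split: if_splits)

lemma in_toggle_iff: "v \<noteq> u \<Longrightarrow> v \<in> toggle u W \<longleftrightarrow> v \<in> W"
  by (auto simp: toggle_def)

lemma partner_toggle: "branch_once T \<Longrightarrow> partner T W = Some u \<Longrightarrow> partner T (toggle u W) = Some u"
proof (induction T)
  case (Branch v s t)
  then have "u \<noteq> v" by (auto split: if_splits dest: partner_in_apexes)
  then show ?case using Branch by (auto simp: in_toggle_iff split: if_splits)
qed auto

text \<open>At a branching on \<open>v\<close>, the members of \<open>R\<close> that contain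
  \<open>v\<close> are upward closed, so they can be collapsed first; the others are upward closed
  in what is left. Toggling never changes membership of \<open>v\<close>, so the matching respects
  both parts.\<close>

lemma collapse_matching_tree:
  assumes "branch_once T" "simplicial_complex X" "finite R" "R \<subseteq> X"
    and "\<And>A B. A \<in> R \<Longrightarrow> B \<in> X \<Longrightarrow> A \<subseteq> B \<Longrightarrow> B \<in> R"
    and "\<And>W. W \<in> R \<Longrightarrow> \<exists>u. partner T W = Some u \<and> toggle u W \<in> R"
  shows "geom_real X homotopy_equivalent_space geom_real (X - R)"
  using assms
proof (induction T arbitrary: X R)
  case (Branch v s t)
  note X = Branch.prems(2) and up = Branch.prems(5) and tog = Branch.prems(6)
  define S where "S = {W \<in> R. v \<in> W}"
  have tog1: "\<exists>u. partner (if v \<in> W then s else t) W = Some u \<and> toggle u W \<in> R \<and> (v \<in> toggle u W \<longleftrightarrow> v \<in> W)"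
    if W: "W \<in> R" for W
  proof -
    obtain u where u: "partner (Branch v s t) W = Some u" "toggle u W \<in> R" using tog[OF W] by blast
    then have "v \<noteq> u" using Branch.prems(1) by (auto split: if_splits dest: partner_in_apexes)
    then show ?thesis using u by (auto simp: in_toggle_iff split: if_splits)
  qed
  have upS: "B \<in> S" if "A \<in> S" "B \<in> X" "A \<subseteq> B" for A B
    using that up by (auto simp: S_def)
  have "geom_real X homotopy_equivalent_space geom_real (X - S)"
  proof (rule Branch.IH(1))
    show "\<exists>u. partner s W = Some u \<and> toggle u W \<in> S" if "W \<in> S" for W
      using that tog1[of W] by (auto simp: S_def)
    show "branch_once s" using Branch.prems(1) by simp
    show "finite S" "S \<subseteq> X" using Branch.prems(3,4) by (auto simp: S_def)
  qed (fact X upS)+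
  moreover have "geom_real (X - S) homotopy_equivalent_space geom_real (X - S - (R - S))"
  proof (rule Branch.IH(2))
    show "\<exists>u. partner t W = Some u \<and> toggle u W \<in> R - S" if "W \<in> R - S" for W
      using that tog1[of W] by (auto simp: S_def)
    show "simplicial_complex (X - S)" by (rule simplicial_complex_diff[OF X]) (rule upS)
    show "B \<in> R - S" if "A \<in> R - S" "B \<in> X - S" "A \<subseteq> B" for A B
      using that up by blast
    show "branch_once t" using Branch.prems(1) by simp
    show "finite (R - S)" "R - S \<subseteq> X - S" using Branch.prems(3,4) by auto
  qed
  moreover have "X - S - (R - S) = X - R" by (auto simp: S_def)
  ultimately show ?case using homotopy_eqv_trans by metis
next
  case (Excluded v t)
  show ?case using Excluded.prems(1,6) by (intro Excluded.IH[OF _ Excluded.prems(2-5)]) auto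
next
  case (Cone u)
  show ?case using Cone.prems(6) by (intro collapse_toggle[OF Cone.prems(2-5), where u = u]) auto
next
  case Critical
  have "R = {}" using Critical.prems(6) by auto
  then show ?case by (simp add: homotopy_equivalent_space_refl)
qed

text \<open>The pairs whose smaller member has more than d elements are removed first, then the
  critical faces, then the remaining pairs; so the critical faces may be treated as facets.\<close>
lemma mtree_collapse_to_facets:
  fixes K :: "nat set set"
  assumes fr: "branch_once T" and K: "simplicial_complex K" and finK: "finite K"
    and pm: "\<And>W u. W \<in> insert {} K \<Longrightarrow> partner T W = Some u \<Longrightarrow> insert u W \<in> K"
    and crit: "\<And>W. W \<in> insert {} K \<Longrightarrow> partner T W = None \<Longrightarrow> card W = Suc d"
  shows "\<exists>K'. simplicial_complex K' \<and> finite K' \<and> geom_real K homotopy_equivalent_space geom_real K' \<and>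
    {W \<in> K. partner T W = None} \<subseteq> K' \<and> (\<forall>W\<in>K'. card W \<le> Suc d) \<and>
    contractible_space (geom_real (K' - {W \<in> K. partner T W = None})) \<and>
    K' - {W \<in> K. partner T W = None} \<noteq> {}"
proof -
  define C where "C = {W \<in> K. partner T W = None}"
  have tog: "toggle u W \<in> insert {} K" if "W \<in> K" "partner T W = Some u" for W u
    using pm[of W u] that simplicial_complexD(3)[OF K that(1), of "W - {u}"] by (auto simp: toggle_def)
  have fin: "finite W" if "W \<in> K" for W using simplicial_complexD(1)[OF K that] .
  \<comment> \<open>At size \<open>Suc d\<close> only the lower members of pairs are removed; the
    upper members of that size are matched with faces of size \<open>d\<close> and stay. This choice
    makes \<open>R\<close> closed under the matching as well as upward.\<close>
  define R where "R = {W \<in> K. Suc d < card W \<or> (card W = Suc d \<and> (\<exists>u. partner T W = Some u \<and> u \<notin> W))}"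
  have upR: "B \<in> R" if "A \<in> R" "B \<in> K" "A \<subseteq> B" for A B
  proof (cases "A = B")
    case False
    then have "card A < card B" using that fin by (simp add: psubset_card_mono psubset_eq)
    then show ?thesis using that by (auto simp: R_def)
  qed (use that in simp)
  define K' where "K' = K - R"
  have K': "simplicial_complex K'" unfolding K'_def by (rule simplicial_complex_diff[OF K upR])
  have "geom_real K homotopy_equivalent_space geom_real (K - R)"
  proof (rule collapse_matching_tree[OF fr K])
    show "\<exists>u. partner T W = Some u \<and> toggle u W \<in> R" if W: "W \<in> R" for W
    proof -
      have WK: "W \<in> K" and cW: "Suc d \<le> card W" using W by (auto simp: R_def)
      have "partner T W \<noteq> None"
      proof
        assume "partner T W = None"
        moreover from this have "card W = Suc d" using crit[of W] WK by simp
        ultimately show False using W by (simp add: R_def)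
      qed
      then obtain u where u: "partner T W = Some u" by blast
      have t: "toggle u W \<in> insert {} K" "partner T (toggle u W) = Some u"
        using tog[OF WK u] partner_toggle[OF fr u] by auto
      have "toggle u W \<in> R"
      proof (cases "u \<in> W")
        case True
        then have c: "card W = Suc (card (toggle u W))"
          using card_Suc_Diff1[OF fin[OF WK] True] by (simp add: toggle_def)
        have "Suc d < card W" using W True u by (auto simp: R_def)
        then have "Suc d \<le> card (toggle u W)" using c by simp
        moreover have "u \<notin> toggle u W" using True by (simp add: toggle_def)
        moreover have "toggle u W \<in> K" using t \<open>Suc d \<le> card (toggle u W)\<close> by auto
        ultimately show ?thesis using t u by (auto simp: R_def)
      next
        case False
        then have "toggle u W = insert u W" "card (insert u W) = Suc (card W)"
          using fin[OF WK] by (auto simp: toggle_def)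
        then show ?thesis using t cW by (auto simp: R_def)
      qed
      then show ?thesis using u by blast
    qed
    show "finite R" "R \<subseteq> K" using finK by (auto simp: R_def)
  qed (fact upR)
  then have 1: "geom_real K homotopy_equivalent_space geom_real K'" by (simp add: K'_def)
  have CK: "C \<subseteq> K'" using crit by (auto simp: C_def K'_def R_def)
  have cK': "card W \<le> Suc d" if "W \<in> K'" for W using that by (auto simp: K'_def R_def)
  have upC: "B \<in> C" if "A \<in> C" "B \<in> K'" "A \<subseteq> B" for A B
  proof -
    have "card A = Suc d" using that(1) crit by (auto simp: C_def)
    then have "A = B" using cK'[OF that(2)] that(3) fin[of B] that(2) card_seteq[of B A] by (auto simp: K'_def)
    then show ?thesis using that by simp
  qed
  define L where "L = K' - C"
  have L: "simplicial_complex L" unfolding L_def by (rule simplicial_complex_diff[OF K' upC])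
  \<comment> \<open>The empty face is matched with a vertex \<open>w\<close>. As the empty face is
    not a simplex, \<open>{w}\<close> is left without a partner, and it is the point to which the
    rest collapses.\<close>
  have "partner T {} \<noteq> None" using crit[of "{}"] by auto
  then obtain w where w: "partner T {} = Some w" by blast
  have wK: "{w} \<in> K" and pw: "partner T {w} = Some w"
    using pm[OF _ w] partner_toggle[OF fr w] by (auto simp: toggle_def)
  have wL: "{w} \<in> L"
    using wK pw by (auto simp: L_def C_def K'_def R_def)
  have LK: "L \<subseteq> K" by (auto simp: L_def K'_def)
  have "geom_real L homotopy_equivalent_space geom_real (L - (L - {{w}}))"
  proof (rule collapse_matching_tree[OF fr L])
    show "B \<in> L - {{w}}" if "A \<in> L - {{w}}" "B \<in> L" "A \<subseteq> B" for A B
      using that simplicial_complexD(2)[OF L] by blast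
    show "\<exists>u. partner T W = Some u \<and> toggle u W \<in> L - {{w}}" if W: "W \<in> L - {{w}}" for W
    proof -
      have WK: "W \<in> K" and W': "W \<in> K'" "W \<notin> C" using W LK by (auto simp: L_def)
      then obtain u where u: "partner T W = Some u" by (auto simp: C_def)
      have t: "toggle u W \<in> insert {} K" "partner T (toggle u W) = Some u"
        using tog[OF WK u] partner_toggle[OF fr u] by auto
      have ne: "toggle u W \<noteq> {}"
      proof
        assume "toggle u W = {}"
        moreover from this have "W = {u}" using simplicial_complexD(2)[OF K WK] by (auto simp: toggle_def split: if_splits)
        ultimately show False using t w W by auto
      qed
      have nw: "toggle u W \<noteq> {w}"
      proof
        assume "toggle u W = {w}"
        moreover from this have "u = w" using t pw by simp
        ultimately have "W = {}" using W by (auto simp: toggle_def split: if_splits)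
        then show False using simplicial_complexD(2)[OF K WK] by simp
      qed
      have "toggle u W \<notin> R"
      proof (cases "u \<in> W")
        case True
        then have "card (toggle u W) < card W"
          using fin[OF WK] by (simp add: toggle_def card_gt_0_iff card_Diff1_less del: card_Diff_insert)
        then show ?thesis using cK'[OF W'(1)] by (auto simp: R_def)
      next
        case False
        \<comment> \<open>A lower member of size \<open>Suc d\<close> would already have been
          removed with \<open>R\<close>, so the larger partner still obeys the size bound.\<close>
        then have "card W \<noteq> Suc d" using W' u WK by (auto simp: K'_def R_def)
        then have "card (toggle u W) \<le> Suc d" using cK'[OF W'(1)] False fin[OF WK] by (simp add: toggle_def)
        moreover have "u \<in> toggle u W" using False by (simp add: toggle_def)
        ultimately show ?thesis using t by (auto simp: R_def)
      qed
      then have "toggle u W \<in> L" using t ne by (auto simp: L_def K'_def C_def)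
      then show ?thesis using u nw by blast
    qed
    show "finite (L - {{w}})" using finite_subset[OF LK finK] by simp
  qed simp
  moreover have "L - (L - {{w}}) = {{w}}" using wL by auto
  moreover have "geom_real_set {{w}} \<subseteq> {\<lambda>v. if v = w then 1 else 0}"
    by (auto simp: geom_real_set_def fun_eq_iff)
  then have "contractible_space (geom_real {{w}})"
    by (intro contractible_space_subset_singleton) (auto simp: geom_real_eq_top_of_set)
  ultimately have "contractible_space (geom_real L)"
    by (simp add: homotopy_equivalent_space_contractibility)
  moreover have "finite K'" using finK by (simp add: K'_def)
  moreover have "L \<noteq> {}" using wL by blast
  ultimately show ?thesis
    using K' 1 CK cK' unfolding C_def[symmetric] L_def by blast
qed

section \<open>Collapsing a contractible subcomplex with complementary facets\<close>

text \<open>A continuous map from a compact space onto a Hausdorff space is closed, hence a quotient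
  map. This gives continuity of maps out of the wedge that are defined through chosen
  preimages.\<close>

lemma continuous_on_compact_factor:
  fixes f :: "'a::t2_space \<Rightarrow> 'b::t2_space" and g :: "'b \<Rightarrow> 'c::topological_space"
  assumes S: "compact S" and f: "continuous_on S f" "f ` S = T"
    and gf: "continuous_on S (\<lambda>x. g (f x))"
  shows "continuous_on T g"
  unfolding continuous_closedin_preimage_eq
proof (intro allI impI)
  fix C :: "'c set" assume C: "closed C"
  define D where "D = S \<inter> (\<lambda>x. g (f x)) -` C"
  have "closedin (top_of_set S) D"
    using continuous_closedin_preimage[OF gf C] by (simp add: D_def)
  then have "compact D" using closedin_compact[OF S] by blast
  moreover have "continuous_on D f" using continuous_on_subset[OF f(1)] by (auto simp: D_def)
  ultimately have "closed (f ` D)" by (intro compact_imp_closed compact_continuous_image)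
  moreover have "T \<inter> g -` C = f ` D" unfolding f(2)[symmetric] D_def by blast
  ultimately show "closedin (top_of_set T) (T \<inter> g -` C)"
    using f(2) by (intro closed_subset) auto
qed

text \<open>The realization is a finite union of closed sets inside a cube, which is compact by
  Tychonoff.\<close>

lemma compact_geom_real_set:
  fixes K :: "'v::countable set set"
  assumes K: "simplicial_complex K" and fin: "finite K"
  shows "compact (geom_real_set K)"
proof -
  define F where "F \<sigma> = {x::'v \<Rightarrow> real. (\<forall>v. 0 \<le> x v) \<and> (\<forall>v\<in>-\<sigma>. x v = 0) \<and> sum x \<sigma> = 1}" for \<sigma>
  have coord: "continuous_on UNIV (\<lambda>x::'v \<Rightarrow> real. x v)" for v by simp
  have "closed (F \<sigma>)" for \<sigma>
  proof -
    have "F \<sigma> = {x. \<forall>v. 0 \<le> x v} \<inter> (\<Inter>v\<in>-\<sigma>. {x. x v = 0}) \<inter> {x. sum x \<sigma> = 1}"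
      by (auto simp: F_def)
    moreover have "closed {x::'v \<Rightarrow> real. \<forall>v. 0 \<le> x v}"
      by (intro closed_Collect_all closed_Collect_le continuous_on_const coord)
    moreover have "closed (\<Inter>v\<in>-\<sigma>. {x::'v \<Rightarrow> real. x v = 0})"
      by (intro closed_INT ballI closed_Collect_eq continuous_on_const coord)
    moreover have "closed {x::'v \<Rightarrow> real. sum x \<sigma> = 1}"
      by (intro closed_Collect_eq continuous_on_const continuous_on_sum coord)
    ultimately show ?thesis by (simp add: closed_Int)
  qed
  then have "closed (\<Union>\<sigma>\<in>K. F \<sigma>)" using fin by (intro closed_UN ballI)
  moreover have "geom_real_set K = (\<Union>\<sigma>\<in>K. F \<sigma>)"
    unfolding geom_real_set_def F_def by blast
  ultimately have cl: "closed (geom_real_set K)" by simp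
  have "compactin (product_topology (\<lambda>i::'v. euclideanreal) UNIV) (PiE UNIV (\<lambda>_. {0..1}))"
    by (simp add: compactin_PiE)
  then have "compact (PiE (UNIV::'v set) (\<lambda>_. {0..1::real}))"
    by (simp add: euclidean_product_topology)
  moreover have "geom_real_set K \<subseteq> PiE UNIV (\<lambda>_. {0..1})"
  proof
    fix x assume x: "x \<in> geom_real_set K"
    have "x v \<le> 1" for v
    proof (cases "x v = 0")
      case False
      have "x v \<le> sum x (supp x)"
        using False geom_real_setD(1)[OF K x] simplicial_complexD(1)[OF K geom_real_setD(2)[OF K x]]
        by (intro member_le_sum) auto
      then show ?thesis using geom_real_setD(3)[OF K x] by simp
    qed simp
    then show "x \<in> PiE UNIV (\<lambda>_. {0..1})" using geom_real_setD(1)[OF K x] by auto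
  qed
  ultimately show ?thesis using cl compact_Int_closed by (metis inf.absorb_iff2)
qed

section \<open>Homotopy extension from a subcomplex whose complement consists of facets\<close>

locale facets =
  fixes K :: "'v::countable set set" and \<sigma> :: "nat \<Rightarrow> 'v set" and e :: "nat \<Rightarrow> nat \<Rightarrow> 'v"
    and n d :: nat
  assumes K: "simplicial_complex K" and finK: "finite K"
    and \<sigma>_in: "k < n \<Longrightarrow> \<sigma> k \<in> K"
    and \<sigma>_maximal: "k < n \<Longrightarrow> B \<in> K \<Longrightarrow> \<sigma> k \<subseteq> B \<Longrightarrow> B = \<sigma> k"
    and \<sigma>_inj: "inj_on \<sigma> {..<n}"
    and e_bij: "k < n \<Longrightarrow> bij_betw (e k) {..d} (\<sigma> k)"
begin

definition L where "L = K - \<sigma> ` {..<n}"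

text \<open>The smallest coordinate measures depth in a facet: on the realization it is positive
  exactly in the interior of that facet. Hence at most one of these functions is nonzero at a point,
  and the realization of \<open>L\<close> is their common zero set.\<close>

definition m :: "nat \<Rightarrow> ('v \<Rightarrow> real) \<Rightarrow> real" where "m k x = Min (x ` \<sigma> k)"

lemma \<sigma>_fin: "k < n \<Longrightarrow> finite (\<sigma> k)" "k < n \<Longrightarrow> \<sigma> k \<noteq> {}"
  using simplicial_complexD(1,2)[OF K \<sigma>_in] by auto

lemma \<sigma>_card: "k < n \<Longrightarrow> card (\<sigma> k) = Suc d"
  using bij_betw_same_card[OF e_bij] by simp

lemma simplicial_complex_L: "simplicial_complex L"
  unfolding L_def by (rule simplicial_complex_diff[OF K]) (use \<sigma>_maximal in blast)

lemma m_le: "k < n \<Longrightarrow> v \<in> \<sigma> k \<Longrightarrow> m k x \<le> x v"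
  unfolding m_def using \<sigma>_fin by (intro Min_le) auto

lemma m_attained: "k < n \<Longrightarrow> \<exists>v\<in>\<sigma> k. x v = m k x"
  using Min_in[of "x ` \<sigma> k"] \<sigma>_fin[of k] by (fastforce simp: m_def)

lemma m_nonneg: "x \<in> geom_real_set K \<Longrightarrow> k < n \<Longrightarrow> 0 \<le> m k x"
  using m_attained[of k x] geom_real_setD(1)[OF K] by metis

lemma supp_eq:
  assumes "x \<in> geom_real_set K" "k < n" "m k x \<noteq> 0"
  shows "supp x = \<sigma> k"
proof -
  have "x v \<noteq> 0" if "v \<in> \<sigma> k" for v
    using m_le[OF assms(2) that, of x] m_nonneg[OF assms(1,2)] assms(3) by linarith
  then show ?thesis using \<sigma>_maximal[OF assms(2) geom_real_setD(2)[OF K assms(1)]] by blast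
qed

lemma m_unique:
  assumes "x \<in> geom_real_set K" "k < n" "m k x \<noteq> 0" "j < n" "j \<noteq> k"
  shows "m j x = 0"
proof (rule ccontr)
  assume "m j x \<noteq> 0"
  then have "\<sigma> j = \<sigma> k" using supp_eq[OF assms(1)] assms(2-4) by metis
  then show False using \<sigma>_inj assms(2,4,5) by (auto dest: inj_onD)
qed

lemma geom_real_L_iff: "x \<in> geom_real_set L \<longleftrightarrow> x \<in> geom_real_set K \<and> (\<forall>k<n. m k x = 0)"
proof (intro iffI conjI allI impI)
  assume x: "x \<in> geom_real_set L"
  then show xK: "x \<in> geom_real_set K" by (auto simp: geom_real_set_def L_def)
  fix k assume k: "k < n"
  have "supp x \<in> L" using geom_real_setD(2)[OF simplicial_complex_L x] .
  then show "m k x = 0" using supp_eq[OF xK k] k by (auto simp: L_def)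
next
  assume x: "x \<in> geom_real_set K \<and> (\<forall>k<n. m k x = 0)"
  then have xK: "x \<in> geom_real_set K" by simp
  have "supp x \<notin> \<sigma> ` {..<n}"
  proof
    assume "supp x \<in> \<sigma> ` {..<n}"
    then obtain k where k: "k < n" "supp x = \<sigma> k" by auto
    then show False using m_attained[OF k(1), of x] x by auto
  qed
  then have "supp x \<in> L" using geom_real_setD(2)[OF K xK] by (simp add: L_def)
  then show "x \<in> geom_real_set L"
    using geom_real_setD[OF K xK] by (intro geom_real_setI[of x "supp x"]) auto
qed

lemma continuous_on_m: "k < n \<Longrightarrow> continuous_on S g \<Longrightarrow> continuous_on S (\<lambda>z. m k (g z))"
  unfolding m_def using \<sigma>_fin by (intro continuous_on_Min)

text \<open>On the realization this depth is scaled to take the value 1 at the barycentre of each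
  facet and 0 on \<open>L\<close>.\<close>

definition u :: "('v \<Rightarrow> real) \<Rightarrow> real" where
  "u x = Suc d * (\<Sum>k<n. m k x)"

text \<open>The cap keeps the total weight removed from a facet at most \<open>s / 2\<close>, so the
  denominator in \<open>push\<close> is at least 1/2 for times up to 1.\<close>

definition mm :: "real \<Rightarrow> nat \<Rightarrow> ('v \<Rightarrow> real) \<Rightarrow> real" where
  "mm s k x = min (s / (2 * Suc d)) (m k x)"

text \<open>Pushes the part of each facet near its boundary radially onto the boundary; at time s the
  complement of the concentric simplex with scaling factor 1 - s/2 lands in the boundary.\<close>
definition push :: "real \<Rightarrow> ('v \<Rightarrow> real) \<Rightarrow> 'v \<Rightarrow> real" where
  "push s x = (\<lambda>w. (x w - (\<Sum>k<n. mm s k x * indicator (\<sigma> k) w)) / (1 - Suc d * (\<Sum>k<n. mm s k x)))"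

lemma sum_mm:
  assumes "x \<in> geom_real_set K" "k < n" "m k x \<noteq> 0" "0 \<le> s"
  shows "(\<Sum>j<n. mm s j x * c j) = mm s k x * c k"
proof -
  have "mm s j x = 0" if "j < n" "j \<noteq> k" for j
    using m_unique[OF assms(1-3) that] assms(4) by (simp add: mm_def)
  then have "(\<Sum>j<n. mm s j x * c j) = (\<Sum>j<n. if j = k then mm s k x * c k else 0)"
    by (intro sum.cong) auto
  then show ?thesis using assms(2) by simp
qed

lemma sum_m:
  assumes "x \<in> geom_real_set K" "k < n" "m k x \<noteq> 0"
  shows "(\<Sum>j<n. m j x) = m k x"
proof -
  have "(\<Sum>j<n. m j x) = (\<Sum>j<n. if j = k then m k x else 0)"
    using m_unique[OF assms] by (intro sum.cong) auto
  then show ?thesis using assms(2) by simp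
qed

lemma mm_bounds:
  assumes "x \<in> geom_real_set K" "k < n" "s \<in> {0..1}"
  shows "0 \<le> mm s k x" "Suc d * mm s k x \<le> s / 2" "mm s k x \<le> m k x"
proof -
  show "0 \<le> mm s k x" "mm s k x \<le> m k x"
    using m_nonneg[OF assms(1,2)] assms(3) by (auto simp: mm_def)
  have "Suc d * mm s k x \<le> Suc d * (s / (2 * Suc d))"
    unfolding mm_def by (intro mult_left_mono) auto
  also have "Suc d * (s / (2 * Suc d)) = s / 2" by (simp add: field_simps)
  finally show "Suc d * mm s k x \<le> s / 2" .
qed

lemma sum_mm_le:
  assumes "x \<in> geom_real_set K" "s \<in> {0..1}"
  shows "Suc d * (\<Sum>k<n. mm s k x) \<le> s / 2"
proof (cases "\<exists>k<n. m k x \<noteq> 0")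
  case True
  then obtain k where k: "k < n" "m k x \<noteq> 0" by blast
  show ?thesis using sum_mm[OF assms(1) k, of s "\<lambda>_. 1"] mm_bounds(2)[OF assms(1) k(1) assms(2)] assms(2) by simp
next
  case False
  then have "(\<Sum>k<n. mm s k x) = 0" using assms(2) by (intro sum.neutral) (auto simp: mm_def)
  then show ?thesis using assms(2) by simp
qed

lemma push_L: "x \<in> geom_real_set L \<Longrightarrow> 0 \<le> s \<Longrightarrow> push s x = x"
  by (simp add: push_def geom_real_L_iff mm_def)

lemma push_0: "x \<in> geom_real_set K \<Longrightarrow> push 0 x = x"
proof -
  assume x: "x \<in> geom_real_set K"
  have "mm 0 k x = 0" if "k < n" for k using m_nonneg[OF x that] by (simp add: mm_def)
  then show ?thesis by (simp add: push_def)
qed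

lemma push_in:
  assumes x: "x \<in> geom_real_set K" and s: "s \<in> {0..1}"
  shows "push s x \<in> geom_real_set K" "2 * u x \<le> s \<Longrightarrow> push s x \<in> geom_real_set L"
proof -
  have "push s x \<in> geom_real_set K \<and> (2 * u x \<le> s \<longrightarrow> push s x \<in> geom_real_set L)"
  proof (cases "\<exists>k<n. m k x \<noteq> 0")
    case False
    then have "x \<in> geom_real_set L" using x geom_real_L_iff by blast
    then show ?thesis using push_L[of x s] x s by simp
  next
    case True
    then obtain k where k: "k < n" and mk: "m k x \<noteq> 0" by blast
    have s0: "0 \<le> s" using s by simp
    define D where "D = 1 - Suc d * mm s k x"
    have D: "D > 0" using mm_bounds(2)[OF x k s] s unfolding D_def by auto
    have "(\<Sum>j<n. mm s j x) = mm s k x"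
      using sum_mm[OF x k mk s0, of "\<lambda>_. 1"] by simp
    then have p: "push s x w = (x w - mm s k x * indicator (\<sigma> k) w) / D" for w
      unfolding push_def D_def sum_mm[OF x k mk s0, of "\<lambda>j. indicator (\<sigma> j) w"] by simp
    have sup: "supp x = \<sigma> k" by (rule supp_eq[OF x k mk])
    have nn: "push s x w \<ge> 0" for w
    proof (cases "w \<in> \<sigma> k")
      case True
      then have "mm s k x \<le> x w" using m_le[OF k True, of x] mm_bounds(3)[OF x k s] by linarith
      then show ?thesis using True D by (simp add: p)
    next
      case False
      then have "x w = 0" using sup by blast
      then show ?thesis using False by (simp add: p)
    qed
    have psup: "supp (push s x) \<subseteq> \<sigma> k"
    proof
      fix w assume w: "w \<in> supp (push s x)"
      show "w \<in> \<sigma> k"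
      proof (rule ccontr)
        assume "w \<notin> \<sigma> k"
        moreover from this have "x w = 0" using sup by blast
        ultimately show False using w by (simp add: p)
      qed
    qed
    have "sum (push s x) (\<sigma> k) = (\<Sum>w\<in>\<sigma> k. x w - mm s k x) / D"
      unfolding sum_divide_distrib by (intro sum.cong) (auto simp: p)
    also have "(\<Sum>w\<in>\<sigma> k. x w - mm s k x) = sum x (\<sigma> k) - Suc d * mm s k x"
      using \<sigma>_card[OF k] by (simp add: sum_subtractf)
    also have "sum x (\<sigma> k) = 1" using sum_eq_1[OF K x _ \<sigma>_fin(1)[OF k]] sup by simp
    finally have "sum (push s x) (\<sigma> k) = 1" using D by (simp add: D_def)
    then have pK: "push s x \<in> geom_real_set K"
      using geom_real_setI[OF nn \<sigma>_in[OF k] psup] by blast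
    moreover have "push s x \<in> geom_real_set L" if us: "2 * u x \<le> s"
    proof -
      \<comment> \<open>The hypothesis says that the cap in \<open>mm\<close> is not active, so the
        full minimum is subtracted and a vertex of the facet loses all its weight.\<close>
      have "2 * (Suc d * m k x) \<le> s" using us sum_m[OF x k mk] by (simp add: u_def)
      then have "m k x \<le> s / (2 * Suc d)" by (simp add: field_simps)
      then have mmk: "mm s k x = m k x" by (simp add: mm_def)
      obtain v where v: "v \<in> \<sigma> k" "x v = m k x" using m_attained[OF k] by blast
      then have pv: "push s x v = 0" using mmk by (simp add: p)
      \<comment> \<open>Positive depth in facet \<open>j\<close> would make the support all of
        \<open>\<sigma> j\<close>. This facet lies in \<open>\<sigma> k\<close> and so equals it,
        although \<open>v\<close> carries no weight any more.\<close>
      have "m j (push s x) = 0" if j: "j < n" for j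
      proof (rule ccontr)
        assume "m j (push s x) \<noteq> 0"
        then have sj: "supp (push s x) = \<sigma> j" by (rule supp_eq[OF pK j])
        then have "\<sigma> j \<subseteq> \<sigma> k" using psup by simp
        then have "\<sigma> k = \<sigma> j" using \<sigma>_maximal[OF j \<sigma>_in[OF k]] by simp
        then show False using v pv sj by auto
      qed
      then show ?thesis using pK geom_real_L_iff by blast
    qed
    ultimately show ?thesis by blast
  qed
  then show "push s x \<in> geom_real_set K" "2 * u x \<le> s \<Longrightarrow> push s x \<in> geom_real_set L" by auto
qed

lemma continuous_on_push:
  "continuous_on ({0..1} \<times> geom_real_set K) (\<lambda>z. push (fst z) (snd z))"
proof (rule continuous_on_coordinatewise_then_product)
  fix w
  let ?S = "{0..1::real} \<times> geom_real_set K"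
  have c: "continuous_on ?S (\<lambda>z. snd z w)"
    by (rule continuous_on_coord[OF continuous_on_snd[OF continuous_on_id]])
  have cm: "continuous_on ?S (\<lambda>z. mm (fst z) k (snd z))" if "k < n" for k
    unfolding mm_def
    by (intro continuous_on_min continuous_on_divide continuous_on_fst continuous_on_id
        continuous_on_const continuous_on_m[OF that continuous_on_snd[OF continuous_on_id]]) auto
  have ne: "1 - Suc d * (\<Sum>k<n. mm (fst z) k (snd z)) \<noteq> 0" if "z \<in> ?S" for z
    using sum_mm_le[of "snd z" "fst z"] that by auto
  show "continuous_on ?S (\<lambda>z. push (fst z) (snd z) w)"
    unfolding push_def
    by (intro continuous_on_divide continuous_on_diff continuous_on_mult continuous_on_sum
        continuous_on_const c) (use cm ne in auto)
qed

lemma continuous_on_u: "continuous_on S g \<Longrightarrow> continuous_on S (\<lambda>z. u (g z))"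
  unfolding u_def
  by (intro continuous_on_mult continuous_on_const continuous_on_sum continuous_on_m) auto

text \<open>This is homotopy extension made explicit. A point is pushed outwards until it reaches
  \<open>L\<close>, and from then on its image is also moved by \<open>h\<close>. Points of
  \<open>L\<close> start there, so on \<open>L\<close> the extension is \<open>h\<close> itself; the
  two formulas agree at the moment of arrival because \<open>h\<close> starts with the
  identity.\<close>

lemma extend_contraction:
  fixes h :: "real \<times> ('v \<Rightarrow> real) \<Rightarrow> 'v \<Rightarrow> real"
  assumes hc: "continuous_on ({0..1} \<times> geom_real_set L) h"
    and hL: "\<And>t x. t \<in> {0..1} \<Longrightarrow> x \<in> geom_real_set L \<Longrightarrow> h (t, x) \<in> geom_real_set L"
    and h0: "\<And>x. x \<in> geom_real_set L \<Longrightarrow> h (0, x) = x"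
  obtains H where "continuous_on ({0..1} \<times> geom_real_set K) H"
    "\<And>t x. t \<in> {0..1} \<Longrightarrow> x \<in> geom_real_set K \<Longrightarrow> H (t, x) \<in> geom_real_set K"
    "\<And>x. x \<in> geom_real_set K \<Longrightarrow> H (0, x) = x"
    "\<And>t x. t \<in> {0..1} \<Longrightarrow> x \<in> geom_real_set L \<Longrightarrow> H (t, x) = h (t, x)"
proof
  let ?S = "{0..1::real} \<times> geom_real_set K"
  define P where "P z = push (fst z) (snd z)" for z
  \<comment> \<open>The point \<open>x\<close> reaches \<open>L\<close> at time
    \<open>2 * u x\<close>, the bound in \<open>push_in\<close>; \<open>- q\<close> is the time
    elapsed since then and serves as the clock of \<open>h\<close>.\<close>
  define q where "q z = 2 * u (snd z) - fst z" for z :: "real \<times> ('v \<Rightarrow> real)"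
  define H where "H z = (if q z \<le> 0 then h (- q z, P z) else P z)" for z
  have u0: "u x \<ge> 0" if "x \<in> geom_real_set K" for x
    unfolding u_def using m_nonneg[OF that] by (intro mult_nonneg_nonneg sum_nonneg) auto
  have uL: "u x = 0" if "x \<in> geom_real_set L" for x
    using that geom_real_L_iff by (simp add: u_def)
  have cq: "continuous_on S q" for S
    unfolding q_def
    by (intro continuous_on_diff continuous_on_mult continuous_on_const continuous_on_u
        continuous_on_fst continuous_on_snd continuous_on_id)
  have q01: "- q z \<in> {0..1}" if "z \<in> ?S" "q z \<le> 0" for z
    using that u0[of "snd z"] by (auto simp: q_def)
  have PL: "P z \<in> geom_real_set L" if "z \<in> ?S" "q z \<le> 0" for z
    using that push_in(2)[of "snd z" "fst z"] by (auto simp: q_def P_def)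
  have PK: "P z \<in> geom_real_set K" if "z \<in> ?S" for z
    using that push_in(1)[of "snd z" "fst z"] by (auto simp: P_def)
  have cP: "continuous_on ?S P" unfolding P_def by (rule continuous_on_push)
  show "continuous_on ?S H"
    unfolding H_def
  proof (rule continuous_on_cases_le)
    show "continuous_on {z \<in> ?S. q z \<le> 0} (\<lambda>z. h (- q z, P z))"
    proof (rule continuous_on_compose2[OF hc])
      show "continuous_on {z \<in> ?S. q z \<le> 0} (\<lambda>z. (- q z, P z))"
        by (intro continuous_on_Pair continuous_on_minus cq continuous_on_subset[OF cP]) auto
    qed (use q01 PL in blast)
    show "continuous_on {z \<in> ?S. 0 \<le> q z} P" by (rule continuous_on_subset[OF cP]) auto
    show "h (- q z, P z) = P z" if "z \<in> ?S" "q z = 0" for z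
      using h0[OF PL[OF that(1)]] that(2) by simp
  qed (rule cq)
  show "H (t, x) \<in> geom_real_set K" if "t \<in> {0..1}" "x \<in> geom_real_set K" for t x
  proof (cases "q (t, x) \<le> 0")
    case True
    then have "h (- q (t, x), P (t, x)) \<in> geom_real_set L"
      using hL[OF q01 PL, of "(t, x)" "(t, x)"] that by simp
    then show ?thesis using True geom_real_L_iff by (simp add: H_def)
  next
    case False
    then show ?thesis using PK[of "(t, x)"] that by (simp add: H_def)
  qed
  show "H (0, x) = x" if x: "x \<in> geom_real_set K" for x
  proof (cases "q (0, x) \<le> 0")
    case True
    then have "q (0, x) = 0" using u0[OF x] by (simp add: q_def)
    then show ?thesis using h0[OF PL[of "(0, x)"]] x push_0[OF x] by (simp add: H_def P_def)
  next
    case False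
    then show ?thesis using push_0[OF x] by (simp add: H_def P_def)
  qed
  show "H (t, x) = h (t, x)" if t: "t \<in> {0..1}" and x: "x \<in> geom_real_set L" for t x
    using uL[OF x] push_L[OF x, of t] t by (simp add: H_def q_def P_def)
qed

end

section \<open>The quotient map onto the wedge of spheres\<close>

context facets
begin

text \<open>On the open facet this is \<open>(m k x)\<^sup>2\<close> times the squared length of the
  vector with entries 1/2 and (x_i - x_0) / m. Clearing the powers of the depth keeps the inversion
  formula meaningful on the boundary.\<close>

definition Dn :: "nat \<Rightarrow> ('v \<Rightarrow> real) \<Rightarrow> real" where
  "Dn k x = (m k x)\<^sup>2 / 4 + (\<Sum>i\<le>d. (x (e k i) - x (e k 0))\<^sup>2) + (1 - sum x (\<sigma> k))\<^sup>2"

text \<open>On the k-th facet the vector with entries 1/2 and (x_i - x_0) / m identifies the open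
  simplex with an affine hyperplane at distance 1/2 from the origin, and the inversion
  y \<mapsto> y / |y|^2 takes this hyperplane to the punctured k-th sphere. The last summand of Dn
  vanishes on that facet; it only keeps the denominator positive elsewhere.\<close>
definition to_wedge :: "('v \<Rightarrow> real) \<Rightarrow> nat \<times> nat \<Rightarrow> real" where
  "to_wedge x = (\<lambda>(k, i). if k < n \<and> i \<le> d then
     (if i = 0 then (m k x)\<^sup>2 / 2 else m k x * (x (e k i) - x (e k 0))) / Dn k x else 0)"

lemma e_in: "k < n \<Longrightarrow> i \<le> d \<Longrightarrow> e k i \<in> \<sigma> k"
  using e_bij[of k] by (auto simp: bij_betw_def)

lemma e_onto: "k < n \<Longrightarrow> v \<in> \<sigma> k \<Longrightarrow> \<exists>i\<le>d. v = e k i"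
  using e_bij[of k] by (auto simp: bij_betw_def)

lemma sum_e: "k < n \<Longrightarrow> (\<Sum>i\<le>d. g (e k i)) = sum g (\<sigma> k)"
  by (rule sum.reindex_bij_betw[OF e_bij])

lemma m_attained_e: "k < n \<Longrightarrow> \<exists>i\<le>d. x (e k i) = m k x"
  using m_attained[of k x] e_onto[of k] by metis

lemma sum_facet:
  assumes "x \<in> geom_real_set K" "k < n" "m k x \<noteq> 0"
  shows "sum x (\<sigma> k) = 1"
  using sum_eq_1[OF K assms(1) _ \<sigma>_fin(1)[OF assms(2)]] supp_eq[OF assms] by simp

text \<open>If all summands vanish, the coordinates on the facet are all equal, their minimum is 0
  and their sum is 1, which is impossible. The bound holds for every function \<open>x\<close>, so
  \<open>to_wedge\<close> is continuous on the whole function space.\<close>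

lemma Dn_pos:
  assumes k: "k < n"
  shows "Dn k x > 0"
proof -
  have nn: "0 \<le> (m k x)\<^sup>2 / 4" "0 \<le> (\<Sum>i\<le>d. (x (e k i) - x (e k 0))\<^sup>2)" "0 \<le> (1 - sum x (\<sigma> k))\<^sup>2"
    by (auto intro: sum_nonneg)
  have "Dn k x \<noteq> 0"
  proof
    assume "Dn k x = 0"
    then have z: "(m k x)\<^sup>2 / 4 = 0" "(\<Sum>i\<le>d. (x (e k i) - x (e k 0))\<^sup>2) = 0" "(1 - sum x (\<sigma> k))\<^sup>2 = 0"
      using nn unfolding Dn_def by linarith+
    have sq: "\<forall>i\<in>{..d}. (x (e k i) - x (e k 0))\<^sup>2 = 0"
      by (rule sum_nonneg_eq_0_iff[THEN iffD1, OF _ _ z(2)]) simp_all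
    have eq: "x (e k i) = x (e k 0)" if "i \<le> d" for i
      using bspec[OF sq, of i] that by simp
    obtain i where i: "i \<le> d" "x (e k i) = m k x" using m_attained_e[OF k] by blast
    then have "x (e k 0) = 0" using eq[OF i(1)] z(1) by simp
    then have "x (e k j) = 0" if "j \<le> d" for j using eq[OF that] by simp
    then have "(\<Sum>i\<le>d. x (e k i)) = 0" by simp
    then show False using z(3) sum_e[OF k, of x] by simp
  qed
  moreover have "Dn k x \<ge> 0" using nn unfolding Dn_def by linarith
  ultimately show ?thesis by linarith
qed

lemma Dn_facet:
  assumes "x \<in> geom_real_set K" "k < n" "m k x \<noteq> 0"
  shows "Dn k x = (m k x)\<^sup>2 / 4 + (\<Sum>i\<le>d. (x (e k i) - x (e k 0))\<^sup>2)"
  by (simp add: Dn_def sum_facet[OF assms])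

lemma to_wedge_0: "x \<in> geom_real_set L \<Longrightarrow> to_wedge x = (\<lambda>_. 0)"
  by (auto simp: to_wedge_def geom_real_L_iff fun_eq_iff)

lemma to_wedge_pos:
  assumes "k < n" "m k x \<noteq> 0"
  shows "to_wedge x (k, 0) > 0"
  using assms Dn_pos[OF assms(1)] by (simp add: to_wedge_def)

lemma wedge_zero: "0 < n \<Longrightarrow> (\<lambda>_. 0) \<in> wedge_spheres_set n d"
  unfolding wedge_spheres_set_def mem_Collect_eq
  by (intro exI[of _ 0]) (auto simp: if_distrib[of "\<lambda>t. t\<^sup>2"] cong: if_cong)

text \<open>The form |y|^2 = 2 y_0 shows why inversion is the right map: it says that y / |y|^2 has
  first coordinate 1/2 whenever y is not the origin.\<close>

lemma sphere_eq_iff: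
  fixes y :: "nat \<Rightarrow> real"
  shows "(\<Sum>i\<le>d. (y i - (if i = 0 then 1 else 0))\<^sup>2) = 1 \<longleftrightarrow> (\<Sum>i\<le>d. (y i)\<^sup>2) = 2 * y 0"
proof -
  have "(\<Sum>i\<le>d. (y i - (if i = 0 then 1 else 0))\<^sup>2) = (\<Sum>i\<le>d. (y i)\<^sup>2 + (if i = 0 then 1 - 2 * y 0 else 0))"
    by (intro sum.cong) (auto simp: power2_diff)
  also have "\<dots> = (\<Sum>i\<le>d. (y i)\<^sup>2) + (1 - 2 * y 0)"
    by (simp add: sum.distrib)
  finally show ?thesis by auto
qed

lemma to_wedge_in:
  assumes n: "0 < n" and x: "x \<in> geom_real_set K"
  shows "to_wedge x \<in> wedge_spheres_set n d"
proof (cases "\<exists>k<n. m k x \<noteq> 0")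
  case False
  then show ?thesis using x geom_real_L_iff to_wedge_0 wedge_zero[OF n] by simp
next
  case True
  then obtain k where k: "k < n" and mk: "m k x \<noteq> 0" by blast
  define S where "S = (\<Sum>i\<le>d. (x (e k i) - x (e k 0))\<^sup>2)"
  define D where "D = Dn k x"
  have D: "D = (m k x)\<^sup>2 / 4 + S" "D > 0"
    unfolding S_def D_def by (rule Dn_facet[OF x k mk]) (rule Dn_pos[OF k])
  \<comment> \<open>The square of the entry with \<open>i = 0\<close> contributes the term
    \<open>(m k x)\<^sup>2 / 4\<close> of \<open>Dn\<close>, while the difference of coordinates
    vanishes at that index.\<close>
  have "(\<Sum>i\<le>d. (to_wedge x (k, i))\<^sup>2)
      = (\<Sum>i\<le>d. (m k x / D)\<^sup>2 * ((x (e k i) - x (e k 0))\<^sup>2 + (if i = 0 then (m k x)\<^sup>2 / 4 else 0)))"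
    using k by (intro sum.cong) (auto simp: to_wedge_def D_def[symmetric] power_divide power_mult_distrib power2_eq_square)
  also have "\<dots> = (m k x / D)\<^sup>2 * D"
    unfolding D(1) by (simp add: sum.distrib S_def flip: sum_distrib_left)
  also have "\<dots> = 2 * to_wedge x (k, 0)"
    using k D(2) by (simp add: to_wedge_def D_def[symmetric] power2_eq_square field_simps)
  finally have "(\<Sum>i\<le>d. (to_wedge x (k, i) - (if i = 0 then 1 else 0))\<^sup>2) = 1"
    using sphere_eq_iff[of "\<lambda>i. to_wedge x (k, i)"] by blast
  moreover have "to_wedge x (j, i) = 0" if "j \<noteq> k \<or> i > d" for j i
    using that m_unique[OF x k mk] by (auto simp: to_wedge_def)
  ultimately show ?thesis using k unfolding wedge_spheres_set_def by blast
qed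

text \<open>Equal images give coordinate differences that are proportional with factor
  \<open>c\<close>, the ratio of the depths. A positive factor preserves the index at which the
  minimum is attained, and the minima have the same ratio, so the coordinates themselves are
  proportional. Both sum to 1, hence \<open>c = 1\<close>.\<close>

lemma to_wedge_inj:
  assumes x: "x \<in> geom_real_set K" and y: "y \<in> geom_real_set K" and eq: "to_wedge x = to_wedge y"
    and nL: "x \<notin> geom_real_set L"
  shows "x = y"
proof -
  obtain k where k: "k < n" and mx: "m k x \<noteq> 0" using nL x geom_real_L_iff by blast
  have my: "m k y \<noteq> 0"
  proof
    assume "m k y = 0"
    then have "to_wedge y (k, 0) = 0" by (simp add: to_wedge_def)
    then show False using to_wedge_pos[OF k mx] eq by simp
  qed
  define c where "c = m k y / m k x"
  have mpos: "m k x > 0" "m k y > 0" using m_nonneg[OF x k] m_nonneg[OF y k] mx my by auto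
  then have c: "c > 0" by (simp add: c_def)
  note Dx = Dn_pos[OF k, of x] and Dy = Dn_pos[OF k, of y]
  have e0: "(m k x)\<^sup>2 / Dn k x = (m k y)\<^sup>2 / Dn k y"
    using fun_cong[OF eq, of "(k, 0)"] k by (simp add: to_wedge_def)
  have diff: "y (e k i) - y (e k 0) = c * (x (e k i) - x (e k 0))" if i: "i \<le> d" for i
  proof (cases "i = 0")
    case False
    define a where "a = x (e k i) - x (e k 0)"
    define b where "b = y (e k i) - y (e k 0)"
    have "m k x * a / Dn k x = m k y * b / Dn k y"
      using fun_cong[OF eq, of "(k, i)"] k i False by (simp add: to_wedge_def a_def b_def)
    then have "(m k x)\<^sup>2 / Dn k x * (a / m k x) = (m k y)\<^sup>2 / Dn k y * (b / m k y)"
      using mpos by (simp add: power2_eq_square)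
    moreover have "(m k y)\<^sup>2 / Dn k y > 0" using mpos Dy by simp
    ultimately have "a / m k x = b / m k y"
      unfolding e0 by (metis less_irrefl mult_left_cancel)
    then have "b = c * a" using mpos by (simp add: c_def field_simps)
    then show ?thesis by (simp add: a_def b_def)
  qed simp
  obtain i where i: "i \<le> d" "x (e k i) = m k x" using m_attained_e[OF k] by blast
  obtain j where j: "j \<le> d" "y (e k j) = m k y" using m_attained_e[OF k] by blast
  have "y (e k i) \<le> y (e k j)"
  proof -
    have "x (e k i) \<le> x (e k j)" using m_le[OF k e_in[OF k j(1)], of x] i by simp
    then have "c * (x (e k i) - x (e k 0)) \<le> c * (x (e k j) - x (e k 0))" using c by simp
    then show ?thesis using diff[OF i(1)] diff[OF j(1)] by linarith
  qed
  then have "y (e k i) = m k y" using m_le[OF k e_in[OF k i(1)], of y] j by simp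
  then have "y (e k i) = c * x (e k i)" using i mpos by (simp add: c_def)
  then have "y (e k 0) = c * x (e k 0)" using diff[OF i(1)] by (simp add: algebra_simps)
  then have yc: "y (e k l) = c * x (e k l)" if "l \<le> d" for l
    using diff[OF that] by (simp add: algebra_simps)
  have "sum y (\<sigma> k) = c * sum x (\<sigma> k)"
    unfolding sum_e[OF k, symmetric] sum_distrib_left using yc by (intro sum.cong) auto
  then have "c = 1" using sum_facet[OF x k mx] sum_facet[OF y k my] by simp
  then have on: "y v = x v" if "v \<in> \<sigma> k" for v using yc e_onto[OF k that] by auto
  show "x = y"
  proof
    fix v
    show "x v = y v"
    proof (cases "v \<in> \<sigma> k")
      case False
      then have "v \<notin> supp x" "v \<notin> supp y" using supp_eq[OF x k mx] supp_eq[OF y k my] by auto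
      then show ?thesis by simp
    qed (simp add: on)
  qed
qed

lemma to_wedge_surj:
  assumes z: "z \<in> wedge_spheres_set n d" and L: "geom_real_set L \<noteq> {}"
  shows "\<exists>x\<in>geom_real_set K. to_wedge x = z"
proof -
  obtain k where k: "k < n" and off: "\<And>j i. j \<noteq> k \<or> i > d \<Longrightarrow> z (j, i) = 0"
    and "(\<Sum>i\<le>d. (z (k, i) - (if i = 0 then 1 else 0))\<^sup>2) = 1"
    using z unfolding wedge_spheres_set_def by blast
  then have sph: "(\<Sum>i\<le>d. (z (k, i))\<^sup>2) = 2 * z (k, 0)"
    using sphere_eq_iff[of "\<lambda>i. z (k, i)"] by blast
  define z0 where "z0 = z (k, 0)"
  show ?thesis
  \<comment> \<open>The origin is the only point of the sphere with first coordinate 0; any point of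
    \<open>L\<close> is mapped to it.\<close>
  proof (cases "z0 = 0")
    case True
    then have "(\<Sum>i\<le>d. (z (k, i))\<^sup>2) = 0" using sph by (simp add: z0_def)
    then have "z (k, i) = 0" if "i \<le> d" for i using that by (simp add: sum_nonneg_eq_0_iff)
    then have "z (j, i) = 0" for j i using off[of j i] by (cases "j = k \<and> i \<le> d") auto
    then have "z = (\<lambda>_. 0)" by auto
    moreover obtain p where "p \<in> geom_real_set L" using L by blast
    ultimately show ?thesis using to_wedge_0 geom_real_L_iff by blast
  next
    case False
    have "0 \<le> (\<Sum>i\<le>d. (z (k, i))\<^sup>2)" by (intro sum_nonneg) simp
    then have z0: "z0 > 0" using sph False by (simp add: z0_def)
    \<comment> \<open>Undoing the inversion divides \<open>z\<close> by its squared length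
      \<open>2 * z0\<close>. Thus \<open>a i\<close> is the value that (x_i - x_0) / m must take,
      which is 0 for \<open>i = 0\<close>.\<close>
    define a where "a i = (if i = 0 then 0 else z (k, i) / (2 * z0))" for i
    define \<mu> where "\<mu> = Min (a ` {..d})"
    \<comment> \<open>The shift makes the minimum 1. After division by \<open>S\<close> the
      coordinates sum to 1, have minimum \<open>1 / S\<close>, and their differences in units of
      that minimum are the prescribed \<open>a i\<close>.\<close>
    define b where "b i = a i - \<mu> + 1" for i
    define S where "S = (\<Sum>i\<le>d. b i)"
    have \<mu>_le: "\<mu> \<le> a i" if "i \<le> d" for i unfolding \<mu>_def using that by (intro Min_le) auto
    have "\<mu> \<in> a ` {..d}" unfolding \<mu>_def by (intro Min_in) auto
    then obtain l where l: "l \<le> d" "a l = \<mu>" by auto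
    have b1: "b i \<ge> 1" if "i \<le> d" for i using \<mu>_le[OF that] by (simp add: b_def)
    have "b i > 0" if "i \<le> d" for i using b1[OF that] by linarith
    then have S: "S > 0" unfolding S_def by (intro sum_pos) auto
    define g where "g = the_inv_into {..d} (e k)"
    have g: "g (e k i) = i" if "i \<le> d" for i
      unfolding g_def using e_bij[OF k] that by (intro the_inv_into_f_f) (auto simp: bij_betw_def)
    define x where "x v = (if v \<in> \<sigma> k then b (g v) / S else 0)" for v
    have xe: "x (e k i) = b i / S" if "i \<le> d" for i using e_in[OF k that] g[OF that] by (simp add: x_def)
    have nn: "x v \<ge> 0" for v
    proof (cases "v \<in> \<sigma> k")
      case True
      then obtain i where "i \<le> d" "v = e k i" using e_onto[OF k] by blast
      then show ?thesis using xe b1[of i] S by simp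
    qed (simp add: x_def)
    have "sum x (\<sigma> k) = (\<Sum>i\<le>d. b i / S)"
      unfolding sum_e[OF k, symmetric] using xe by (intro sum.cong) auto
    also have "\<dots> = 1" using S by (simp add: S_def flip: sum_divide_distrib)
    finally have sum1: "sum x (\<sigma> k) = 1" .
    have "supp x \<subseteq> \<sigma> k" by (auto simp: x_def)
    then have xK: "x \<in> geom_real_set K" by (intro geom_real_setI[OF nn \<sigma>_in[OF k] _ sum1])
    have mk: "m k x = 1 / S"
    proof -
      obtain i where i: "i \<le> d" "x (e k i) = m k x" using m_attained_e[OF k] by blast
      then have "m k x = b i / S" using xe by simp
      moreover have "b i / S \<ge> 1 / S" using b1[OF i(1)] S by (simp add: divide_right_mono)
      moreover have "m k x \<le> 1 / S"
        using m_le[OF k e_in[OF k l(1)], of x] xe[OF l(1)] l(2) by (simp add: b_def)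
      ultimately show ?thesis by linarith
    qed
    then have mk0: "m k x \<noteq> 0" using S by simp
    have b0: "b i - b 0 = a i" for i by (simp add: b_def a_def)
    have df: "x (e k i) - x (e k 0) = a i / S" if "i \<le> d" for i
      using xe[OF that] xe[of 0] b0[of i] by (simp flip: diff_divide_distrib)
    have "Dn k x = (1 / S)\<^sup>2 / 4 + (\<Sum>i\<le>d. (a i / S)\<^sup>2)"
      using Dn_facet[OF xK k mk0] df mk by simp
    also have "(\<Sum>i\<le>d. (a i / S)\<^sup>2) = (\<Sum>i\<le>d. (a i)\<^sup>2) / S\<^sup>2"
      by (simp add: power_divide sum_divide_distrib)
    also have "(\<Sum>i\<le>d. (a i)\<^sup>2) = (\<Sum>i\<le>d. ((z (k, i))\<^sup>2 - (if i = 0 then z0\<^sup>2 else 0)) / (4 * z0\<^sup>2))"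
      by (intro sum.cong) (auto simp: a_def z0_def power_divide power_mult_distrib)
    also have "\<dots> = (2 * z0 - z0\<^sup>2) / (4 * z0\<^sup>2)"
      using sph by (simp add: sum_subtractf z0_def flip: sum_divide_distrib)
    \<comment> \<open>This is the squared depth times the squared length 1 / (2 z0) of the inverted
      point.\<close>
    finally have Dn: "Dn k x = 1 / (2 * z0 * S\<^sup>2)"
      using z0 S by (simp add: field_simps power2_eq_square)
    have "to_wedge x (j, i) = z (j, i)" for j i
    proof (cases "j = k \<and> i \<le> d")
      case False
      then show ?thesis using off[of j i] m_unique[OF xK k mk0, of j] by (auto simp: to_wedge_def)
    next
      case True
      then have "to_wedge x (j, i) = (if i = 0 then (1 / S)\<^sup>2 / 2 else 1 / S * (a i / S)) / (1 / (2 * z0 * S\<^sup>2))"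
        using k df[of i] by (simp only: to_wedge_def mk Dn prod.case simp_thms if_True)
      also have "\<dots> = (if i = 0 then z0 else 2 * z0 * a i)"
        using z0 S by (simp add: power2_eq_square)
      also have "\<dots> = z (j, i)" using True z0 by (simp add: a_def z0_def)
      finally show ?thesis .
    qed
    then have "to_wedge x = z" by auto
    then show ?thesis using xK by blast
  qed
qed

lemma continuous_on_to_wedge: "continuous_on S to_wedge"
proof (rule continuous_on_coordinatewise_then_product)
  fix p :: "nat \<times> nat"
  obtain k i where p: "p = (k, i)" by fastforce
  have c: "continuous_on S (\<lambda>x. x v)" for v :: 'v
    by (rule continuous_on_coord[OF continuous_on_id])
  show "continuous_on S (\<lambda>x. to_wedge x p)"
  proof (cases "k < n \<and> i \<le> d")
    case True
    then have k: "k < n" by simp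
    note cm = continuous_on_m[OF k continuous_on_id]
    have cD: "continuous_on S (Dn k)"
      unfolding Dn_def
      by (intro continuous_on_add continuous_on_divide continuous_on_power continuous_on_sum
          continuous_on_diff continuous_on_const c cm) auto
    have ne: "\<forall>x\<in>S. Dn k x \<noteq> 0" using Dn_pos[OF k] by (metis less_irrefl)
    have "continuous_on S (\<lambda>x. (m k x)\<^sup>2 / 2 / Dn k x)"
      "continuous_on S (\<lambda>x. m k x * (x (e k i) - x (e k 0)) / Dn k x)"
      by (intro continuous_on_divide[OF _ cD ne] continuous_on_mult continuous_on_diff
          continuous_on_divide continuous_on_power continuous_on_const c cm; simp)+
    then show ?thesis using True p by (cases "i = 0") (simp_all add: to_wedge_def)
  next
    case False
    then show ?thesis by (auto simp: to_wedge_def p)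
  qed
qed

text \<open>The homotopy inverse sends a point of the wedge to the end position, under the extended
  contraction \<open>H\<close>, of any of its preimages. This is well defined because
  \<open>to_wedge\<close> is injective off \<open>L\<close>, while the end map is constant on
  \<open>L\<close>. The composite on \<open>K\<close> is the end of \<open>H\<close>; the composite
  on the wedge is the end of the homotopy induced by \<open>H\<close>, which exists because
  \<open>H\<close> keeps \<open>L\<close> inside \<open>L\<close>.\<close>

theorem homotopy_equivalent_wedge:
  assumes n: "0 < n" and ne: "L \<noteq> {}" and con: "contractible_space (geom_real L)"
  shows "geom_real K homotopy_equivalent_space wedge_spheres n d"
proof -
  let ?K = "geom_real_set K" and ?L = "geom_real_set L" and ?W = "wedge_spheres_set n d"
  let ?f = to_wedge
  obtain \<tau> where \<tau>: "\<tau> \<in> L" using ne by blast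
  then obtain v where "v \<in> \<tau>" using simplicial_complexD(2)[OF simplicial_complex_L] by blast
  then have "(\<lambda>w. if w = v then 1 else 0) \<in> ?L"
    using \<tau> simplicial_complexD(1)[OF simplicial_complex_L \<tau>] by (intro geom_real_setI[of _ \<tau>]) auto
  then have Lne: "?L \<noteq> {}" by blast
  obtain p where "homotopic_with_canon (\<lambda>x. True) ?L ?L id (\<lambda>x. p)"
    using con by (auto simp: contractible_space_def geom_real_eq_top_of_set)
  then obtain h where
    "continuous_map (prod_topology (top_of_set {0..1::real}) (top_of_set ?L)) (top_of_set ?L) h"
    and h01: "\<forall>x. h (0, x) = id x" "\<forall>x. h (1, x) = p"
    unfolding homotopic_with_def by blast
  moreover have "prod_topology (top_of_set {0..1::real}) (top_of_set ?L) = top_of_set ({0..1} \<times> ?L)"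
    by (simp flip: subtopology_Times)
  ultimately have hc: "continuous_on ({0..1} \<times> ?L) h" and hL: "h \<in> {0..1} \<times> ?L \<rightarrow> ?L" by simp_all
  have h0: "h (0, x) = x" and h1: "h (1, x) = p" for x using h01 by simp_all
  have hL': "h (t, x) \<in> ?L" if "t \<in> {0..1}" "x \<in> ?L" for t x using hL that by blast
  obtain H where Hc: "continuous_on ({0..1::real} \<times> ?K) H"
    and HK: "\<And>t x. t \<in> {0..1} \<Longrightarrow> x \<in> ?K \<Longrightarrow> H (t, x) \<in> ?K"
    and H0: "\<And>x. x \<in> ?K \<Longrightarrow> H (0, x) = x"
    and HL: "\<And>t x. t \<in> {0..1} \<Longrightarrow> x \<in> ?L \<Longrightarrow> H (t, x) = h (t, x)"
    using extend_contraction[OF hc hL' h0] by metis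
  have surj: "?f ` ?K = ?W"
    using to_wedge_in[OF n] to_wedge_surj[OF _ Lne] by (auto simp: image_iff)
  \<comment> \<open>The choice is ambiguous only over the origin, where all preimages lie in
    \<open>L\<close>.\<close>
  define sel where "sel z = (SOME x. x \<in> ?K \<and> ?f x = z)" for z
  have sel: "sel z \<in> ?K" "?f (sel z) = z" if "z \<in> ?W" for z
    using someI_ex[of "\<lambda>x. x \<in> ?K \<and> ?f x = z"] to_wedge_surj[OF that Lne] unfolding sel_def by auto
  have sel_f: "sel (?f x) = x \<or> (sel (?f x) \<in> ?L \<and> x \<in> ?L)" if x: "x \<in> ?K" for x
  proof -
    have s: "sel (?f x) \<in> ?K" "?f (sel (?f x)) = ?f x" using sel[OF to_wedge_in[OF n x]] by auto
    show ?thesis using to_wedge_inj[OF s(1) x s(2)] to_wedge_inj[OF x s(1) s(2)[symmetric]] by metis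
  qed
  have H1: "H (1, sel (?f x)) = H (1, x)" if x: "x \<in> ?K" for x
    using sel_f[OF x] HL[of 1] h1 by auto
  have fH: "?f (H (t, sel (?f x))) = ?f (H (t, x))" if x: "x \<in> ?K" and t: "t \<in> {0..1}" for x t
    using sel_f[OF x] HL[OF t] hL'[OF t] to_wedge_0 by auto
  define g where "g z = H (1, sel z)" for z
  have cK: "compact ?K" by (rule compact_geom_real_set[OF K finK])
  have cH1: "continuous_on ?K (\<lambda>x. H (1, x))"
    by (rule continuous_on_compose2[OF Hc])
      (auto intro!: continuous_on_Pair continuous_on_const continuous_on_id)
  have cg: "continuous_on ?W g"
  proof (rule continuous_on_compact_factor[OF cK continuous_on_to_wedge surj])
    show "continuous_on ?K (\<lambda>x. g (?f x))"
      using cH1 by (rule continuous_on_eq) (simp add: g_def H1)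
  qed
  have gK: "g z \<in> ?K" if "z \<in> ?W" for z using HK[of 1] sel(1)[OF that] by (simp add: g_def)
  have gf: "homotopic_with_canon (\<lambda>x. True) ?K ?K id (g \<circ> ?f)"
    by (rule homotopic_canonI[OF Hc HK]) (auto simp: H0 H1 g_def)
  \<comment> \<open>The product of the time interval with the compact realization is compact, so
    \<open>G\<close> is again a quotient map and the homotopy on the wedge can be tested before
    descending.\<close>
  define G where "G z = (fst z, ?f (snd z))" for z :: "real \<times> ('v \<Rightarrow> real)"
  define M where "M z = ?f (H (fst z, sel (snd z)))" for z :: "real \<times> (nat \<times> nat \<Rightarrow> real)"
  have cM: "continuous_on ({0..1} \<times> ?W) M"
  proof (rule continuous_on_compact_factor)
    show "compact ({0..1::real} \<times> ?K)" by (intro compact_Times cK compact_Icc)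
    show "continuous_on ({0..1} \<times> ?K) G"
      unfolding G_def
      by (intro continuous_on_Pair continuous_on_fst continuous_on_id
          continuous_on_compose2[OF continuous_on_to_wedge[of UNIV] continuous_on_snd]) auto
    show "G ` ({0..1} \<times> ?K) = {0..1} \<times> ?W"
      unfolding surj[symmetric] G_def by force
    have "continuous_on ({0..1} \<times> ?K) (\<lambda>z. ?f (H z))"
      by (rule continuous_on_compose2[OF continuous_on_to_wedge[of UNIV] Hc]) simp
    then show "continuous_on ({0..1} \<times> ?K) (\<lambda>z. M (G z))"
      by (rule continuous_on_eq) (auto simp: M_def G_def fH)
  qed
  have fg: "homotopic_with_canon (\<lambda>x. True) ?W ?W id (?f \<circ> g)"
  proof (rule homotopic_canonI[OF cM])
    show "M (t, z) \<in> ?W" if "t \<in> {0..1}" "z \<in> ?W" for t z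
      using to_wedge_in[OF n HK[OF that(1) sel(1)[OF that(2)]]] by (simp add: M_def)
    show "M (0, z) = id z" if "z \<in> ?W" for z using sel[OF that] H0 by (simp add: M_def)
    show "M (1, z) = (?f \<circ> g) z" for z by (simp add: M_def g_def)
  qed
  show ?thesis
    unfolding homotopy_equivalent_space_def geom_real_eq_top_of_set wedge_spheres_eq_top_of_set
  proof (intro exI conjI)
    show "continuous_map (top_of_set ?K) (top_of_set ?W) ?f"
      using continuous_on_to_wedge to_wedge_in[OF n] by simp
    show "continuous_map (top_of_set ?W) (top_of_set ?K) g" using cg gK by simp
    show "homotopic_with_canon (\<lambda>x. True) ?K ?K (g \<circ> ?f) id"
      "homotopic_with_canon (\<lambda>x. True) ?W ?W (?f \<circ> g) id"
      using gf fg homotopic_with_symD by blast+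
  qed
qed

end

theorem homotopy_equivalent_wedge_of_facets:
  fixes K :: "'v::countable set set"
  assumes K: "simplicial_complex K" "finite K" and C: "C \<subseteq> K" "C \<noteq> {}"
    and facet: "\<And>A B. A \<in> C \<Longrightarrow> B \<in> K \<Longrightarrow> A \<subseteq> B \<Longrightarrow> B = A"
    and dim: "\<And>A. A \<in> C \<Longrightarrow> card A = Suc d"
    and L: "K - C \<noteq> {}" "contractible_space (geom_real (K - C))"
  shows "geom_real K homotopy_equivalent_space wedge_spheres (card C) d"
proof -
  have finC: "finite C" using C K finite_subset by blast
  obtain \<sigma> where "bij_betw \<sigma> {0..<card C} C" using ex_bij_betw_nat_finite[OF finC] by blast
  then have inj: "inj_on \<sigma> {..<card C}" and im: "\<sigma> ` {..<card C} = C"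
    by (auto simp: bij_betw_def atLeast0LessThan)
  have \<sigma>: "\<sigma> k \<in> C" if "k < card C" for k using im that by blast
  have "\<exists>e. bij_betw e {..d} (\<sigma> k)" if k: "k < card C" for k
  proof -
    have "finite (\<sigma> k)" using simplicial_complexD(1)[OF K(1)] \<sigma>[OF k] C(1) by blast
    then obtain e where "bij_betw e {0..<card (\<sigma> k)} (\<sigma> k)" using ex_bij_betw_nat_finite by blast
    then show ?thesis using dim[OF \<sigma>[OF k]] by (auto simp: atLeast0LessThan lessThan_Suc_atMost)
  qed
  then obtain e where e: "\<And>k. k < card C \<Longrightarrow> bij_betw (e k) {..d} (\<sigma> k)" by metis
  interpret facets K \<sigma> e "card C" d
    using K \<sigma> C(1) facet inj e by unfold_locales blast+
  show ?thesis
    using homotopy_equivalent_wedge L C(2) finC by (simp add: L_def im card_gt_0_iff)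
qed

section \<open>Certifying matching trees\<close>

text \<open>Finite sets are encoded as numbers so that checking a tree becomes bit arithmetic on
  numerals.\<close>

definition bits :: "nat \<Rightarrow> nat set" where "bits m = {i. bit m i}"

lemma bits_simps:
  "bits (or a b) = bits a \<union> bits b" "bits (and a b) = bits a \<inter> bits b"
  "bits 0 = {}" "bits (2 ^ v) = {v}"
  by (auto simp: bits_def bit_or_iff bit_and_iff bit_exp_iff)

lemma bits_eq_iff: "bits a = bits b \<longleftrightarrow> a = b"
  by (auto simp: bits_def intro: bit_eqI)

lemma bits_xor: "bit V v \<Longrightarrow> bits (xor V (2 ^ v)) = bits V - {v}"
  by (auto simp: bits_def bit_xor_iff bit_exp_iff)

lemma and_eq_iff_bits: "and c m = c \<longleftrightarrow> bits c \<subseteq> bits m"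
  by (simp only: bits_eq_iff[symmetric] bits_simps Int_absorb2[symmetric] inf.absorb_iff1 eq_commute)

definition mask_of :: "nat list \<Rightarrow> nat" where
  "mask_of xs = foldr (\<lambda>i. or (2 ^ i)) xs 0"

lemma bits_mask_of: "bits (mask_of xs) = set xs"
  by (induction xs) (simp_all add: mask_of_def bits_simps)

section \<open>The 28 edges, their conflicts and the closed V-paths\<close>

text \<open>The edges of the Hasse diagram of the 3-simplex, with simplices encoded as bit masks.\<close>
definition edges :: "(nat \<times> nat) list" where
  "edges =
    [(1, 3), (1, 5), (1, 9), (2, 3), (2, 6), (2, 10), (3, 7), (3, 11), (4, 5), (4, 6), (4,
    12), (5, 7), (5, 13), (6, 7), (6, 14), (7, 15), (8, 9), (8, 10), (8, 12), (9, 11), (9,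
    13), (10, 11), (10, 14), (11, 15), (12, 13), (12, 14), (13, 15), (14, 15)]
"

text \<open>Positions in edges of the edge from {a} to {a, b}, and of the edge from the complement of {a, b} to
  the complement of {a}; the diagonal entries are irrelevant.\<close>
definition low_index :: "nat \<Rightarrow> nat \<Rightarrow> nat" where
  "low_index a b = [[0, 0, 1, 2], [3, 0, 4, 5], [8, 9, 0, 10], [16, 17, 18, 0]] ! a ! b"

definition high_index :: "nat \<Rightarrow> nat \<Rightarrow> nat" where
  "high_index a b = [[0, 25, 22, 14], [24, 0, 20, 12], [21, 19, 0, 7], [13, 11, 6, 0]] ! a ! b"

text \<open>A V-path runs through the low edges of a, b, c, ... in the opposite order, whence rev below.\<close>
definition vertex_cycles :: "(nat \<Rightarrow> nat \<Rightarrow> nat) \<Rightarrow> nat list list" where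
  "vertex_cycles ix =
     [[ix a b, ix b c, ix c a]. a \<leftarrow> [0..<4], b \<leftarrow> [0..<4], c \<leftarrow> [0..<4], distinct [a, b, c]] @
     [[ix a b, ix b c, ix c e, ix e a].
       a \<leftarrow> [0..<4], b \<leftarrow> [0..<4], c \<leftarrow> [0..<4], e \<leftarrow> [0..<4], distinct [a, b, c, e]]"

text \<open>Each closed path is listed once for every starting point, so a cycle of a self-map is
  found wherever it is entered; \<open>cycle_masks\<close> drops the repetitions.\<close>

definition cycles :: "nat list list" where
  "cycles = map rev (vertex_cycles low_index) @ vertex_cycles high_index"

lemma triangle_in_cycles:
  assumes "ix \<in> {low_index, high_index}" "a \<in> {0..3}" "b \<in> {0..3}" "c \<in> {0..3}" "distinct [a, b, c]"
  shows "\<exists>l\<in>set cycles. set l \<subseteq> {ix a b, ix b c, ix c a}"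
proof -
  have "[ix a b, ix b c, ix c a] \<in> set (vertex_cycles ix)"
    using assms(2-) unfolding vertex_cycles_def by fastforce
  then have "[ix a b, ix b c, ix c a] \<in> set cycles \<or> rev [ix a b, ix b c, ix c a] \<in> set cycles"
    using assms(1) unfolding cycles_def by (metis UnCI imageI insertE set_append set_map singletonD)
  then show ?thesis by (elim disjE bexI[rotated]) auto
qed

lemma square_in_cycles:
  assumes "ix \<in> {low_index, high_index}" "a \<in> {0..3}" "b \<in> {0..3}" "c \<in> {0..3}" "e \<in> {0..3}"
    "distinct [a, b, c, e]"
  shows "\<exists>l\<in>set cycles. set l \<subseteq> {ix a b, ix b c, ix c e, ix e a}"
proof -
  have "[ix a b, ix b c, ix c e, ix e a] \<in> set (vertex_cycles ix)"
    using assms(2-) unfolding vertex_cycles_def by fastforce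
  then have "[ix a b, ix b c, ix c e, ix e a] \<in> set cycles \<or> rev [ix a b, ix b c, ix c e, ix e a] \<in> set cycles"
    using assms(1) unfolding cycles_def by (metis UnCI imageI insertE set_append set_map singletonD)
  then show ?thesis by (elim disjE bexI[rotated]) auto
qed

lemma cycles_eq: "cycles =
    [[8, 4, 0], [16, 5, 0], [3, 9, 1], [16, 10, 1], [3, 17, 2], [8, 18, 2], [9, 1, 3], [17, 2,
    3], [0, 8, 4], [17, 10, 4], [0, 16, 5], [9, 18, 5], [4, 0, 8], [18, 2, 8], [1, 3, 9], [18,
    5, 9], [1, 16, 10], [4, 17, 10], [5, 0, 16], [10, 1, 16], [2, 3, 17], [10, 4, 17], [2, 8,
    18], [5, 9, 18], [16, 10, 4, 0], [8, 18, 5, 0], [16, 5, 9, 1], [3, 17, 10, 1], [8, 4, 17,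
    2], [3, 9, 18, 2], [17, 10, 1, 3], [9, 18, 2, 3], [17, 2, 8, 4], [0, 16, 10, 4], [9, 1,
    16, 5], [0, 8, 18, 5], [18, 5, 0, 8], [4, 17, 2, 8], [18, 2, 3, 9], [1, 16, 5, 9], [4, 0,
    16, 10], [1, 3, 17, 10], [10, 4, 0, 16], [5, 9, 1, 16], [10, 1, 3, 17], [2, 8, 4, 17], [5,
    0, 8, 18], [2, 3, 9, 18], [25, 20, 21], [25, 12, 13], [22, 19, 24], [22, 7, 13], [14, 11,
    24], [14, 6, 21], [24, 22, 19], [24, 14, 11], [20, 21, 25], [20, 7, 11], [12, 13, 25],
    [12, 6, 19], [21, 25, 20], [21, 14, 6], [19, 24, 22], [19, 12, 6], [7, 13, 22], [7, 11,
    20], [13, 25, 12], [13, 22, 7], [11, 24, 14], [11, 20, 7], [6, 21, 14], [6, 19, 12], [25,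
    20, 7, 13], [25, 12, 6, 21], [22, 19, 12, 13], [22, 7, 11, 24], [14, 11, 20, 21], [14, 6,
    19, 24], [24, 22, 7, 11], [24, 14, 6, 19], [20, 21, 14, 11], [20, 7, 13, 25], [12, 13, 22,
    19], [12, 6, 21, 25], [21, 25, 12, 6], [21, 14, 11, 20], [19, 24, 14, 6], [19, 12, 13,
    22], [7, 13, 25, 20], [7, 11, 24, 22], [13, 25, 20, 7], [13, 22, 19, 12], [11, 24, 22, 7],
    [11, 20, 21, 14], [6, 21, 25, 12], [6, 19, 24, 14]]"
  by (simp add: cycles_def vertex_cycles_def low_index_def high_index_def upt_rec numeral_2_eq_2[symmetric])

definition shares :: "nat \<Rightarrow> nat \<Rightarrow> bool" where
  "shares i j \<longleftrightarrow> fst (edges ! i) = fst (edges ! j) \<or> fst (edges ! i) = snd (edges ! j) \<or>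
     snd (edges ! i) = fst (edges ! j) \<or> snd (edges ! i) = snd (edges ! j)"

lemma shares_sym: "shares i j \<longleftrightarrow> shares j i"
  by (auto simp: shares_def)

text \<open>Acyclic matchings in terms of positions in \<open>edges\<close>, with the empty matching
  included; \<open>good_imp_acyclic\<close> and \<open>acyclic_imp_good\<close> prove the
  equivalence.\<close>

definition good :: "nat set \<Rightarrow> bool" where
  "good W \<longleftrightarrow> W \<subseteq> {..<28} \<and> (\<forall>i\<in>W. \<forall>j\<in>W. i \<noteq> j \<longrightarrow> \<not> shares i j) \<and> (\<forall>c\<in>set cycles. \<not> set c \<subseteq> W)"

lemma good_mono: "good W \<Longrightarrow> Z \<subseteq> W \<Longrightarrow> good Z"
  unfolding good_def by blast

definition compatible :: "nat \<Rightarrow> nat" where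
  "compatible v = mask_of (filter (\<lambda>j. j \<noteq> v \<and> \<not> shares v j) [0..<28])"

text \<open>Each mask is a closed path through \<open>v\<close> with \<open>v\<close> taken out;
  once all of it has been chosen, \<open>v\<close> can no longer be added.\<close>

definition closing :: "nat \<Rightarrow> nat list" where
  "closing v = remdups (map (\<lambda>c. mask_of (removeAll v c)) (filter (\<lambda>c. v \<in> set c) cycles))"

definition cycle_masks :: "nat list" where
  "cycle_masks = remdups (map mask_of cycles)"

lemma bits_compatible: "bits (compatible v) = {j. j < 28 \<and> j \<noteq> v \<and> \<not> shares v j}"
  by (auto simp: compatible_def bits_mask_of)

text \<open>Here I and V encode the vertices already chosen and those still available.\<close>
fun certifies :: "matching_tree \<Rightarrow> nat \<Rightarrow> nat \<Rightarrow> nat \<Rightarrow> bool" where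
  "certifies (Branch v s t) I V n \<longleftrightarrow>
     bit V v \<and> certifies s (or I (2 ^ v)) (and V (compatible v)) (Suc n) \<and> certifies t I (xor V (2 ^ v)) n"
| "certifies (Excluded v t) I V n \<longleftrightarrow>
     bit V v \<and> list_ex (\<lambda>c. and c I = c) (closing v) \<and> certifies t I (xor V (2 ^ v)) n"
| "certifies (Cone u) I V n \<longleftrightarrow>
     bit V u \<and> and V (compatible u) = xor V (2 ^ u) \<and> list_all (\<lambda>c. and c (or I V) \<noteq> c) (closing u)"
| "certifies Critical I V n \<longleftrightarrow> V = 0 \<and> n = 5 \<and> list_all (\<lambda>c. and c I \<noteq> c) cycle_masks"

fun num_critical :: "matching_tree \<Rightarrow> nat" where
  "num_critical (Branch v s t) = num_critical s + num_critical t"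
| "num_critical (Excluded v t) = num_critical t"
| "num_critical (Cone u) = 0"
| "num_critical Critical = 1"

definition faces :: "nat \<Rightarrow> nat \<Rightarrow> nat set set" where
  "faces I V = {W. bits I \<subseteq> W \<and> W \<subseteq> bits I \<union> bits V \<and> good W}"

text \<open>The invariant of a walk down the tree: chosen elements conflict neither with each other
  nor with available ones. What remains to be checked concerns only pairs of available elements and
  closed paths.\<close>

definition state :: "nat \<Rightarrow> nat \<Rightarrow> bool" where
  "state I V \<longleftrightarrow> bits I \<inter> bits V = {} \<and> bits I \<union> bits V \<subseteq> {..<28} \<and>
     (\<forall>i\<in>bits I. \<forall>j\<in>bits I \<union> bits V. i \<noteq> j \<longrightarrow> \<not> shares i j)"

lemma finite_faces: "finite (faces I V)"
  by (rule finite_subset[of _ "Pow {..<28}"]) (auto simp: faces_def good_def)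

lemma closingD: "c \<in> set (closing v) \<Longrightarrow> \<exists>l\<in>set cycles. v \<in> set l \<and> bits c = set l - {v}"
  by (auto simp: closing_def bits_mask_of)

lemma closingI: "l \<in> set cycles \<Longrightarrow> v \<in> set l \<Longrightarrow> \<exists>c\<in>set (closing v). bits c = set l - {v}"
  by (force simp: closing_def bits_mask_of)

lemma faces_in:
  assumes st: "state I V" and v: "bit V v"
  shows "faces (or I (2 ^ v)) (and V (compatible v)) = {W \<in> faces I V. v \<in> W}"
    "state (or I (2 ^ v)) (and V (compatible v))"
    "card (bits (or I (2 ^ v))) = Suc (card (bits I))"
proof -
  have vV: "v \<in> bits V" using v by (simp add: bits_def)
  have fin: "finite (bits I)" using st finite_subset[of "bits I" "{..<28}"] by (simp add: state_def)
  show "card (bits (or I (2 ^ v))) = Suc (card (bits I))"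
  proof -
    have "v \<notin> bits I" using st vV by (auto simp: state_def)
    then show ?thesis using fin by (simp add: bits_simps)
  qed
  show "state (or I (2 ^ v)) (and V (compatible v))"
    using st vV shares_sym by (auto simp: state_def bits_simps bits_compatible)
  show "faces (or I (2 ^ v)) (and V (compatible v)) = {W \<in> faces I V. v \<in> W}"
  proof (intro set_eqI iffI)
    fix W assume W: "W \<in> {W \<in> faces I V. v \<in> W}"
    then have "W - {v} \<subseteq> bits (compatible v)" by (auto simp: faces_def good_def bits_compatible)
    then show "W \<in> faces (or I (2 ^ v)) (and V (compatible v))"
      using W by (auto simp: faces_def bits_simps)
  qed (use vV in \<open>auto simp: faces_def bits_simps\<close>)
qed

lemma faces_out:
  assumes st: "state I V" and v: "bit V v"
  shows "faces I (xor V (2 ^ v)) = {W \<in> faces I V. v \<notin> W}" "state I (xor V (2 ^ v))"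
proof -
  have "v \<in> bits V" using v by (simp add: bits_def)
  then show "faces I (xor V (2 ^ v)) = {W \<in> faces I V. v \<notin> W}" "state I (xor V (2 ^ v))"
    using st by (auto simp: faces_def state_def bits_xor[OF v])
qed

text \<open>For \<open>Excluded\<close>, the rest of a closed path through \<open>v\<close> is
  already chosen. For \<open>Cone\<close>, the apex conflicts with nothing available and no closed
  path through it fits into the chosen and available elements, so adding it never leaves the family.
  For \<open>Critical\<close>, nothing is available and the only face is the chosen set, with 5
  elements.\<close>

lemma certifies_sound:
  assumes "certifies T I V n" "state I V" "card (bits I) = n"
  shows "branch_once T \<and> apexes T \<subseteq> bits V \<and>
    (\<forall>W\<in>faces I V. \<forall>u. partner T W = Some u \<longrightarrow> insert u W \<in> faces I V) \<and>
    (\<forall>W\<in>faces I V. partner T W = None \<longrightarrow> card W = 5) \<and>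
    card {W \<in> faces I V. partner T W = None} = num_critical T"
  using assms
proof (induction T arbitrary: I V n)
  case (Branch v s t)
  have v: "bit V v" using Branch.prems by simp
  note fin = faces_in[OF Branch.prems(2) v] and fout = faces_out[OF Branch.prems(2) v]
  have s: "branch_once s" "apexes s \<subseteq> bits (and V (compatible v))"
    "\<And>W u. W \<in> faces I V \<Longrightarrow> v \<in> W \<Longrightarrow> partner s W = Some u \<Longrightarrow> insert u W \<in> faces I V"
    "\<And>W. W \<in> faces I V \<Longrightarrow> v \<in> W \<Longrightarrow> partner s W = None \<Longrightarrow> card W = 5"
    "card {W \<in> {W \<in> faces I V. v \<in> W}. partner s W = None} = num_critical s"
    using Branch.IH(1)[OF _ fin(2), of "Suc n"] Branch.prems fin(1,3) by auto
  have t: "branch_once t" "apexes t \<subseteq> bits (xor V (2 ^ v))"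
    "\<And>W u. W \<in> faces I V \<Longrightarrow> v \<notin> W \<Longrightarrow> partner t W = Some u \<Longrightarrow> insert u W \<in> faces I V"
    "\<And>W. W \<in> faces I V \<Longrightarrow> v \<notin> W \<Longrightarrow> partner t W = None \<Longrightarrow> card W = 5"
    "card {W \<in> {W \<in> faces I V. v \<notin> W}. partner t W = None} = num_critical t"
    using Branch.IH(2)[OF _ fout(2), of n] Branch.prems fout(1) by auto
  \<comment> \<open>The branching vertex ceases to be available on both sides, so it is no apex
    below; this is how \<open>branch_once\<close> is obtained.\<close>
  have ap: "v \<in> bits V" "apexes s \<subseteq> bits V - {v}" "apexes t \<subseteq> bits V - {v}"
    using s(2) t(2) v by (auto simp: bits_simps bits_xor[OF v] bits_compatible) (simp add: bits_def)
  have "{W \<in> faces I V. partner (Branch v s t) W = None} =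
      {W \<in> {W \<in> faces I V. v \<in> W}. partner s W = None} \<union> {W \<in> {W \<in> faces I V. v \<notin> W}. partner t W = None}"
    by auto
  then have "card {W \<in> faces I V. partner (Branch v s t) W = None} = num_critical (Branch v s t)"
    using s(5) t(5) by (simp add: card_Un_disjoint finite_faces disjoint_iff)
  moreover have "branch_once (Branch v s t)" "apexes (Branch v s t) \<subseteq> bits V" using s(1) t(1) ap by auto
  moreover have "insert u W \<in> faces I V" if "W \<in> faces I V" "partner (Branch v s t) W = Some u" for W u
    using that s(3) t(3) by (cases "v \<in> W") simp_all
  moreover have "card W = 5" if "W \<in> faces I V" "partner (Branch v s t) W = None" for W
    using that s(4) t(4) by (cases "v \<in> W") simp_all
  ultimately show ?case by blast
next
  case (Excluded v t)
  have v: "bit V v" using Excluded.prems by simp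
  obtain c where c: "c \<in> set (closing v)" "bits c \<subseteq> bits I"
    using Excluded.prems(1) by (auto simp: list_ex_iff and_eq_iff_bits)
  obtain l where l: "l \<in> set cycles" "v \<in> set l" "bits c = set l - {v}" using closingD[OF c(1)] by blast
  have nv: "v \<notin> W" if W: "W \<in> faces I V" for W
  proof
    assume "v \<in> W"
    then have "set l \<subseteq> W" using W l(3) c(2) by (auto simp: faces_def)
    then show False using W l(1) by (auto simp: faces_def good_def)
  qed
  then have eq: "faces I (xor V (2 ^ v)) = faces I V" using faces_out(1)[OF Excluded.prems(2) v] by auto
  have "apexes t \<subseteq> bits V" if "apexes t \<subseteq> bits (xor V (2 ^ v))"
    using that by (auto simp: bits_xor[OF v])
  then show ?case
    using Excluded.IH[OF _ faces_out(2)[OF Excluded.prems(2) v], of n] Excluded.prems by (simp add: eq)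
next
  case (Cone u)
  have u: "bit V u" and "bits (and V (compatible u)) = bits (xor V (2 ^ u))"
    using Cone.prems(1) by simp_all
  then have V: "bits V \<inter> bits (compatible u) = bits V - {u}"
    by (simp add: bits_simps bits_xor)
  have uV: "u \<in> bits V" using u by (simp add: bits_def)
  have cl: "\<not> bits c \<subseteq> bits I \<union> bits V" if "c \<in> set (closing u)" for c
    using Cone.prems(1) that by (auto simp: list_all_iff and_eq_iff_bits bits_simps)
  have "insert u W \<in> faces I V" if W: "W \<in> faces I V" for W
  proof -
    have sub: "W \<subseteq> bits I \<union> bits V" "good W" using W by (auto simp: faces_def)
    have "\<not> shares u j" if "j \<in> W" "j \<noteq> u" for j
    proof (cases "j \<in> bits V")
      case True
      then have "j \<in> bits (compatible u)" using V that by blast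
      then show ?thesis by (simp add: bits_compatible)
    next
      case False
      then have "j \<in> bits I" using sub that by blast
      then show ?thesis using Cone.prems(2) uV that shares_sym unfolding state_def by blast
    qed
    moreover have "\<not> set l \<subseteq> insert u W" if l: "l \<in> set cycles" for l
    proof
      assume sl: "set l \<subseteq> insert u W"
      show False
      proof (cases "u \<in> set l")
        case True
        then obtain c where "c \<in> set (closing u)" "bits c = set l - {u}" using closingI[OF l] by blast
        then show False using cl sl sub(1) by blast
      next
        case False
        then show False using sl l sub(2) unfolding good_def by blast
      qed
    qed
    moreover have "u < 28" using Cone.prems(2) uV by (auto simp: state_def)
    ultimately have "good (insert u W)"
      using sub(2) shares_sym unfolding good_def by (metis insertE insert_subset lessThan_iff)
    then show ?thesis using W uV by (auto simp: faces_def)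
  qed
  then show ?case using uV by auto
next
  case Critical
  have V: "bits V = {}" and n: "n = 5" using Critical.prems(1) by (auto simp: bits_simps)
  have "good (bits I)"
    using Critical.prems(1,2) V
    by (auto simp: good_def state_def list_all_iff cycle_masks_def and_eq_iff_bits bits_mask_of)
  then have "faces I V = {bits I}" using V by (auto simp: faces_def)
  then have "{W \<in> faces I V. partner Critical W = None} = {bits I}" "\<forall>W\<in>faces I V. card W = 5"
    using Critical.prems(3) n by auto
  then show ?case by simp
qed

section \<open>Cyclic matchings on the 3-simplex\<close>

text \<open>Relabelling of vertices, used to pass from positions to edges of the Hasse diagram.
  Coordinates are carried along the injection and extended by 0.\<close>

lemma homeomorphic_geom_real_image:
  assumes K: "simplicial_complex K" and inj: "inj_on \<phi> (\<Union>K)"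
  shows "geom_real K homeomorphic_space geom_real ((`) \<phi> ` K)"
proof -
  let ?U = "\<Union>K"
  define F where "F x = (\<lambda>w. if w \<in> \<phi> ` ?U then x (inv_into ?U \<phi> w) else 0)" for x :: "'a \<Rightarrow> real"
  define G where "G y = (\<lambda>v. if v \<in> ?U then y (\<phi> v) else 0)" for y :: "'b \<Rightarrow> real"
  have inv: "inv_into ?U \<phi> (\<phi> v) = v" if "v \<in> ?U" for v using inj that by simp
  have F\<phi>: "F x (\<phi> v) = x v" if "v \<in> ?U" for x v using that inv by (simp add: F_def)
  have F_in: "F x \<in> geom_real_set ((`) \<phi> ` K)" if x: "x \<in> geom_real_set K" for x
  proof -
    obtain \<sigma> where \<sigma>: "\<forall>v. x v \<ge> 0" "\<sigma> \<in> K" "supp x \<subseteq> \<sigma>" "sum x \<sigma> = 1"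
      using x by (auto simp: geom_real_set_def)
    have \<sigma>U: "\<sigma> \<subseteq> ?U" using \<sigma>(2) by blast
    show ?thesis
    proof (rule geom_real_setI)
      show "F x w \<ge> 0" for w using \<sigma>(1) by (simp add: F_def)
      show "\<phi> ` \<sigma> \<in> (`) \<phi> ` K" using \<sigma>(2) by blast
      show "supp (F x) \<subseteq> \<phi> ` \<sigma>"
      proof
        fix w assume w: "w \<in> supp (F x)"
        then have "w \<in> \<phi> ` ?U" by (auto simp: F_def split: if_splits)
        then obtain v where v: "v \<in> ?U" "w = \<phi> v" by blast
        then have "v \<in> supp x" using w F\<phi> by simp
        then show "w \<in> \<phi> ` \<sigma>" using v \<sigma>(3) by blast
      qed
      have "sum (F x) (\<phi> ` \<sigma>) = sum x \<sigma>"
        using F\<phi> \<sigma>U by (simp add: sum.reindex[OF inj_on_subset[OF inj \<sigma>U]] subset_iff)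
      then show "sum (F x) (\<phi> ` \<sigma>) = 1" using \<sigma>(4) by simp
    qed
  qed
  have G_in: "G y \<in> geom_real_set K \<and> F (G y) = y" if y: "y \<in> geom_real_set ((`) \<phi> ` K)" for y
  proof -
    obtain \<sigma> where \<sigma>: "\<forall>v. y v \<ge> 0" "\<sigma> \<in> K" "supp y \<subseteq> \<phi> ` \<sigma>" "sum y (\<phi> ` \<sigma>) = 1"
      using y by (auto simp: geom_real_set_def)
    have \<sigma>U: "\<sigma> \<subseteq> ?U" using \<sigma>(2) by blast
    have "G y \<in> geom_real_set K"
    proof (rule geom_real_setI)
      show "G y v \<ge> 0" for v using \<sigma>(1) by (simp add: G_def)
      show "supp (G y) \<subseteq> \<sigma>"
      proof
        fix v assume v: "v \<in> supp (G y)"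
        then have vU: "v \<in> ?U" and "\<phi> v \<in> supp y" by (auto simp: G_def split: if_splits)
        then obtain v' where v': "v' \<in> \<sigma>" "\<phi> v = \<phi> v'" using \<sigma>(3) by blast
        then have "v = v'" using inj_onD[OF inj v'(2) vU] \<sigma>U by blast
        then show "v \<in> \<sigma>" using v'(1) by simp
      qed
      have "sum (G y) \<sigma> = sum y (\<phi> ` \<sigma>)"
        using \<sigma>U by (simp add: sum.reindex[OF inj_on_subset[OF inj \<sigma>U]] G_def subset_iff)
      then show "sum (G y) \<sigma> = 1" using \<sigma>(4) by simp
    qed (rule \<sigma>(2))
    moreover have "F (G y) w = y w" for w
    proof (cases "w \<in> \<phi> ` ?U")
      case True
      then obtain v where v: "v \<in> ?U" "w = \<phi> v" by blast
      then show ?thesis using F\<phi> by (simp add: G_def)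
    next
      case False
      then have "w \<notin> supp y" using \<sigma>(3) \<sigma>U by blast
      then show ?thesis using False by (simp add: F_def)
    qed
    ultimately show ?thesis by blast
  qed
  have GF: "G (F x) = x" if x: "x \<in> geom_real_set K" for x
  proof
    fix v
    have "supp x \<subseteq> ?U" using geom_real_setD(2)[OF K x] by blast
    then show "G (F x) v = x v" using F\<phi> by (auto simp: G_def)
  qed
  have cont: "continuous_on S F" "continuous_on S' G" for S S'
  proof -
    have "continuous_on S (\<lambda>x. F x w)" for w
      unfolding F_def
      by (cases "w \<in> \<phi> ` ?U"; simp) (rule continuous_on_coord[OF continuous_on_id])
    then show "continuous_on S F" by (rule continuous_on_coordinatewise_then_product)
    have "continuous_on S' (\<lambda>y. G y v)" for v
      unfolding G_def
      by (cases "v \<in> ?U"; simp) (rule continuous_on_coord[OF continuous_on_id])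
    then show "continuous_on S' G" by (rule continuous_on_coordinatewise_then_product)
  qed
  have "homeomorphic_maps (geom_real K) (geom_real ((`) \<phi> ` K)) F G"
    unfolding homeomorphic_maps_def geom_real_eq_top_of_set
    using cont F_in G_in GF by (simp add: Pi_iff)
  then show ?thesis by (rule homeomorphic_maps_imp_homeomorphic_space)
qed

text \<open>Follow one point for four steps. Among five points of a set with at most four elements
  two coincide, and consecutive ones never do, so the period found is 2, 3 or 4.\<close>

lemma self_map_has_short_cycle:
  assumes C: "C \<subseteq> {0..3::nat}" "C \<noteq> {}" and f: "\<And>a. a \<in> C \<Longrightarrow> f a \<in> C \<and> f a \<noteq> a"
  obtains (two) a where "a \<in> C" "f (f a) = a"
  | (three) a b c where "a \<in> C" "b \<in> C" "c \<in> C" "distinct [a, b, c]" "f a = b" "f b = c" "f c = a"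
  | (four) a b c e where "a \<in> C" "b \<in> C" "c \<in> C" "e \<in> C" "distinct [a, b, c, e]"
      "f a = b" "f b = c" "f c = e" "f e = a"
proof -
  obtain a0 where a0: "a0 \<in> C" using C by blast
  define a1 a2 a3 a4 where "a1 = f a0" and "a2 = f a1" and "a3 = f a2" and "a4 = f a3"
  then have fa: "f a0 = a1" "f a1 = a2" "f a2 = a3" "f a3 = a4" by simp_all
  have m: "a1 \<in> C" "a2 \<in> C" "a3 \<in> C" "a4 \<in> C" and ne: "a1 \<noteq> a0" "a2 \<noteq> a1" "a3 \<noteq> a2" "a4 \<noteq> a3"
    using f[of a0] f[of a1] f[of a2] f[of a3] a0 unfolding fa by blast+
  show thesis
  proof (cases "a2 = a0 \<or> a3 = a1 \<or> a4 = a2")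
    case True
    then show ?thesis
    proof (elim disjE)
      assume "a2 = a0"
      then show ?thesis using two[of a0] a0 fa by simp
    next
      assume "a3 = a1"
      then show ?thesis using two[of a1] m fa by simp
    next
      assume "a4 = a2"
      then show ?thesis using two[of a2] m fa by simp
    qed
  next
    case nt: False
    show ?thesis
    proof (cases "a3 = a0 \<or> a4 = a1")
      case True
      then show ?thesis
      proof
        assume "a3 = a0"
        then show ?thesis using three[of a0 a1 a2] a0 m ne fa nt by simp
      next
        assume "a4 = a1"
        then show ?thesis using three[of a1 a2 a3] m ne fa nt by simp
      qed
    next
      \<comment> \<open>Without an earlier repetition the first four points exhaust the vertices,
        and the fifth can only be the first.\<close>
      case False
      then have dist: "distinct [a0, a1, a2, a3]"
        using ne nt unfolding distinct.simps list.set insert_iff empty_iff by blast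
      have "{a0, a1, a2, a3} \<subseteq> {0..3}" using a0 m C(1) by blast
      moreover have "card {a0, a1, a2, a3} = card {0..3::nat}" using dist by simp
      ultimately have "{a0, a1, a2, a3} = {0..3}" by (intro card_subset_eq) simp_all
      then have "a4 \<in> {a0, a1, a2, a3}" using m(4) C(1) by blast
      then have "a4 = a0" using False ne nt by simp
      then show ?thesis using four[of a0 a1 a2 a3] a0 m dist fa by simp
    qed
  qed
qed

section \<open>From directed cycles to self-maps of the vertex set\<close>

lemma hasse_edgesD:
  assumes "(\<sigma>, \<tau>) \<in> hasse_edges K"
  shows "\<sigma> \<in> K" "\<tau> \<in> K" "\<sigma> \<subset> \<tau>" "card \<tau> = Suc (card \<sigma>)"
  using assms by (auto simp: hasse_edges_def)

text \<open>A directed cycle stays within two consecutive dimensions n and n + 1: whatever is reached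
  from dimension n + 2 never returns to dimension n, since the step down is along a matched edge.\<close>
lemma cyclic_matching_levels:
  assumes M: "is_matching K W" and cyc: "\<not> acyclic ((hasse_edges K - W) \<union> W\<inverse>)"
  shows "\<exists>n C. C \<subseteq> K \<and> (\<exists>\<sigma>\<in>C. card \<sigma> = n) \<and> (\<exists>\<tau>\<in>C. card \<tau> = Suc n) \<and>
    (\<forall>\<sigma>\<in>C. card \<sigma> = n \<longrightarrow> (\<exists>\<tau>\<in>C. (\<sigma>, \<tau>) \<in> hasse_edges K - W) \<and> (\<exists>\<tau>\<in>C. (\<sigma>, \<tau>) \<in> W)) \<and>
    (\<forall>\<tau>\<in>C. card \<tau> = Suc n \<longrightarrow> (\<exists>\<sigma>\<in>C. (\<sigma>, \<tau>) \<in> W) \<and> (\<exists>\<sigma>\<in>C. (\<sigma>, \<tau>) \<in> hasse_edges K - W))"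
proof -
  let ?H = "hasse_edges K"
  define R where "R = (?H - W) \<union> W\<inverse>"
  have WH: "W \<subseteq> ?H" using M by (simp add: is_matching_def)
  have uniq: "e = e'" if "e \<in> W" "e' \<in> W" "{fst e, snd e} \<inter> {fst e', snd e'} \<noteq> {}" for e e'
    using M that unfolding is_matching_def by blast
  have step: "((a, b) \<in> ?H - W \<and> card b = Suc (card a)) \<or> ((b, a) \<in> W \<and> card a = Suc (card b))"
    if "(a, b) \<in> R" for a b
    using that WH hasse_edgesD(4) unfolding R_def by blast
  obtain x where x: "(x, x) \<in> R\<^sup>+" using cyc by (auto simp: acyclic_def R_def)
  \<comment> \<open>The strongly connected component of \<open>x\<close> replaces a single cycle:
    each of its members has a successor and a predecessor inside it.\<close>
  define C where "C = {y. (x, y) \<in> R\<^sup>* \<and> (y, x) \<in> R\<^sup>*}"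
  have xC: "x \<in> C" by (simp add: C_def)
  have loop: "(y, y) \<in> R\<^sup>+" if "y \<in> C" for y
    using that x unfolding C_def by (auto intro: rtrancl_trancl_trancl trancl_rtrancl_trancl)
  have succ: "\<exists>z\<in>C. (y, z) \<in> R" if y: "y \<in> C" for y
  proof -
    obtain z where z: "(y, z) \<in> R" "(z, y) \<in> R\<^sup>*" using tranclD[OF loop[OF y]] by blast
    then have "z \<in> C" using y unfolding C_def by (auto intro: rtrancl_trans rtrancl_into_rtrancl)
    then show ?thesis using z by blast
  qed
  have pred: "\<exists>z\<in>C. (z, y) \<in> R" if y: "y \<in> C" for y
  proof -
    obtain z where z: "(y, z) \<in> R\<^sup>*" "(z, y) \<in> R" using tranclD2[OF loop[OF y]] by blast
    then have "z \<in> C" using y unfolding C_def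
      by (auto intro: rtrancl_trans converse_rtrancl_into_rtrancl)
    then show ?thesis using z by blast
  qed
  define n where "n = (LEAST k. k \<in> card ` C)"
  have "n \<in> card ` C" unfolding n_def by (rule LeastI[of _ "card x"]) (use xC in blast)
  then obtain \<sigma>0 where \<sigma>0: "\<sigma>0 \<in> C" "card \<sigma>0 = n" by blast
  have n_le: "n \<le> card y" if "y \<in> C" for y unfolding n_def using that by (intro Least_le) blast
  \<comment> \<open>This set is a trap. A face of size \<open>Suc n\<close> in it is the lower end
    of a matched edge, so it cannot also be the upper end of one and no step leads down from it. A
    step down from higher up arrives at the lower end of a matched edge and stays in the
    set.\<close>
  define D where "D = {y. Suc (Suc n) \<le> card y \<or> (card y = Suc n \<and> (\<exists>t. (y, t) \<in> W))}"
  have D_step: "b \<in> D" if a: "a \<in> D" and ab: "(a, b) \<in> R" for a b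
    using step[OF ab]
  proof
    assume "(a, b) \<in> ?H - W \<and> card b = Suc (card a)"
    then show ?thesis using a by (auto simp: D_def)
  next
    assume ba: "(b, a) \<in> W \<and> card a = Suc (card b)"
    have "\<not> (\<exists>t. (a, t) \<in> W)"
    proof
      assume "\<exists>t. (a, t) \<in> W"
      then obtain t where "(a, t) \<in> W" by blast
      then have "(a, t) = (b, a)" using uniq[of "(a, t)" "(b, a)"] ba by simp
      then show False using ba by simp
    qed
    then have "Suc (Suc n) \<le> card a" using a by (simp add: D_def)
    then have "Suc n \<le> card b" using ba by simp
    then show ?thesis using ba by (auto simp: D_def)
  qed
  have D_star: "b \<in> D" if "(a, b) \<in> R\<^sup>*" "a \<in> D" for a b
    using that by (induction rule: rtrancl_induct) (use D_step in blast)+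
  have notD: "y \<notin> D" if y: "y \<in> C" for y
  proof
    assume "y \<in> D"
    moreover have "(y, \<sigma>0) \<in> R\<^sup>*" using y \<sigma>0(1) unfolding C_def by (auto intro: rtrancl_trans)
    ultimately have "\<sigma>0 \<in> D" using D_star by blast
    then show False using \<sigma>0(2) by (simp add: D_def)
  qed
  have C_card: "card y = n \<or> card y = Suc n" if "y \<in> C" for y
    using notD[OF that] n_le[OF that] by (auto simp: D_def)
  have up: "\<exists>\<tau>\<in>C. (\<sigma>, \<tau>) \<in> ?H - W" if \<sigma>: "\<sigma> \<in> C" "card \<sigma> = n" for \<sigma>
  proof -
    obtain \<tau> where \<tau>: "\<tau> \<in> C" "(\<sigma>, \<tau>) \<in> R" using succ[OF \<sigma>(1)] by blast
    then show ?thesis using step[OF \<tau>(2)] n_le[OF \<tau>(1)] \<sigma>(2) by auto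
  qed
  have down: "\<exists>\<sigma>\<in>C. (\<sigma>, \<tau>) \<in> W" if \<tau>: "\<tau> \<in> C" "card \<tau> = Suc n" for \<tau>
  proof -
    obtain \<sigma> where \<sigma>: "\<sigma> \<in> C" "(\<tau>, \<sigma>) \<in> R" using succ[OF \<tau>(1)] by blast
    then show ?thesis using step[OF \<sigma>(2)] C_card[OF \<sigma>(1)] \<tau>(2) by auto
  qed
  have from_above: "\<exists>\<tau>\<in>C. (\<sigma>, \<tau>) \<in> W" if \<sigma>: "\<sigma> \<in> C" "card \<sigma> = n" for \<sigma>
  proof -
    obtain \<tau> where \<tau>: "\<tau> \<in> C" "(\<tau>, \<sigma>) \<in> R" using pred[OF \<sigma>(1)] by blast
    then show ?thesis using step[OF \<tau>(2)] n_le[OF \<tau>(1)] \<sigma>(2) by auto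
  qed
  have from_below: "\<exists>\<sigma>\<in>C. (\<sigma>, \<tau>) \<in> ?H - W" if \<tau>: "\<tau> \<in> C" "card \<tau> = Suc n" for \<tau>
  proof -
    obtain \<sigma> where \<sigma>: "\<sigma> \<in> C" "(\<sigma>, \<tau>) \<in> R" using pred[OF \<tau>(1)] by blast
    then show ?thesis using step[OF \<sigma>(2)] C_card[OF \<sigma>(1)] \<tau>(2) by auto
  qed
  have CK: "C \<subseteq> K"
  proof
    fix y assume "y \<in> C"
    then obtain z where "(y, z) \<in> R" using succ by blast
    then show "y \<in> K" using WH hasse_edgesD(1,2) unfolding R_def by blast
  qed
  have "\<exists>\<tau>\<in>C. card \<tau> = Suc n" using up[OF \<sigma>0] \<sigma>0(2) hasse_edgesD(4) by force
  then show ?thesis using CK \<sigma>0 up down from_above from_below by (intro exI[of _ n] exI[of _ C]) blast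
qed

lemma Delta3_subsets: "\<sigma> \<in> Delta3 \<Longrightarrow> \<sigma> \<subseteq> {0..3}" "\<sigma> \<in> Delta3 \<Longrightarrow> finite \<sigma>" "\<sigma> \<in> Delta3 \<Longrightarrow> \<sigma> \<noteq> {}"
  by (auto simp: Delta3_def intro: finite_subset)

definition low :: "nat \<Rightarrow> nat \<Rightarrow> nat set \<times> nat set" where
  "low a b = ({a}, {a, b})"

text \<open>A triangle is named by the vertex it misses. Complementation of vertex sets thus turns
  the level of edges and triangles into the level of vertices and edges, and one argument treats
  both.\<close>

definition high :: "nat \<Rightarrow> nat \<Rightarrow> nat set \<times> nat set" where
  "high a b = ({0..3} - {a, b}, {0..3} - {a})"

text \<open>On the lower level \<open>f\<close> sends a vertex to the other end of its matched edge,
  which goes against the directed cycle. On the upper level it sends a triangle to the other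
  triangle at its matched edge, which goes along the cycle. On the top level the matched edge and
  the unmatched one would coincide, as there is only one tetrahedron.\<close>

lemma cyclic_matching_Delta3:
  assumes M: "is_matching Delta3 W" and cyc: "\<not> acyclic ((hasse_edges Delta3 - W) \<union> W\<inverse>)"
  obtains C f l where "l \<in> {low, high}" "C \<subseteq> {0..3}" "C \<noteq> {}"
    "\<And>a. a \<in> C \<Longrightarrow> f a \<in> C \<and> f a \<noteq> a \<and> l a (f a) \<in> W"
proof -
  obtain n C where CK: "C \<subseteq> Delta3" and C0: "\<exists>\<sigma>\<in>C. card \<sigma> = n" "\<exists>\<tau>\<in>C. card \<tau> = Suc n"
    and up: "\<And>\<sigma>. \<sigma> \<in> C \<Longrightarrow> card \<sigma> = n \<Longrightarrow> \<exists>\<tau>\<in>C. (\<sigma>, \<tau>) \<in> hasse_edges Delta3 - W"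
    and down: "\<And>\<tau>. \<tau> \<in> C \<Longrightarrow> card \<tau> = Suc n \<Longrightarrow> \<exists>\<sigma>\<in>C. (\<sigma>, \<tau>) \<in> W"
    and from_above: "\<And>\<sigma>. \<sigma> \<in> C \<Longrightarrow> card \<sigma> = n \<Longrightarrow> \<exists>\<tau>\<in>C. (\<sigma>, \<tau>) \<in> W"
    and from_below: "\<And>\<tau>. \<tau> \<in> C \<Longrightarrow> card \<tau> = Suc n \<Longrightarrow> \<exists>\<sigma>\<in>C. (\<sigma>, \<tau>) \<in> hasse_edges Delta3 - W"
    using cyclic_matching_levels[OF M cyc] by blast
  have WH: "W \<subseteq> hasse_edges Delta3" using M by (simp add: is_matching_def)
  obtain \<sigma>0 \<tau>0 where \<sigma>0: "\<sigma>0 \<in> C" "card \<sigma>0 = n" and \<tau>0: "\<tau>0 \<in> C" "card \<tau>0 = Suc n" using C0 by blast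
  have "card \<tau>0 \<le> card {0..3::nat}" using Delta3_subsets(1) CK \<tau>0 by (intro card_mono) auto
  moreover have "card \<sigma>0 \<noteq> 0"
    using Delta3_subsets(2,3)[of \<sigma>0] CK \<sigma>0(1) by (simp add: subset_iff)
  ultimately have "n \<noteq> 0" "n \<le> 3" using \<sigma>0(2) \<tau>0(2) by simp_all
  then consider "n = 1" | "n = 2" | "n = 3" by linarith
  then show thesis
  proof cases
    case 1
    define B where "B = {a. {a} \<in> C}"
    have B: "\<exists>b. b \<in> B \<and> b \<noteq> a \<and> low a b \<in> W" if a: "a \<in> B" for a
    proof -
      obtain \<tau> where \<tau>: "\<tau> \<in> C" "({a}, \<tau>) \<in> W" using from_above[of "{a}"] a 1 by (auto simp: B_def)
      have ct: "card \<tau> = 2" "{a} \<subset> \<tau>" using hasse_edgesD(3,4)[of "{a}" \<tau> Delta3] subsetD[OF WH \<tau>(2)] by simp_all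
      then obtain b where b: "\<tau> = {a, b}" "b \<noteq> a" by (auto simp: card_2_iff)
      obtain \<sigma> where \<sigma>: "\<sigma> \<in> C" "(\<sigma>, \<tau>) \<in> hasse_edges Delta3 - W" using from_below[OF \<tau>(1)] ct 1 by auto
      then have "card \<sigma> = 1" "\<sigma> \<subset> \<tau>" using hasse_edgesD(3,4)[of \<sigma> \<tau> Delta3] ct by simp_all
      then obtain c where c: "\<sigma> = {c}" "c = a \<or> c = b" using b by (auto simp: card_1_singleton_iff)
      \<comment> \<open>For \<open>c = a\<close> the same edge of the Hasse diagram would be both
        matched and unmatched.\<close>
      then have "c = b" using \<sigma>(2) \<tau>(2) by auto
      then show ?thesis using c \<sigma>(1) b \<tau>(2) by (auto simp: B_def low_def)
    qed
    then obtain f where "\<And>a. a \<in> B \<Longrightarrow> f a \<in> B \<and> f a \<noteq> a \<and> low a (f a) \<in> W" by metis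
    moreover have "B \<noteq> {}" using \<sigma>0 1 by (auto simp: B_def card_1_singleton_iff)
    moreover have "B \<subseteq> {0..3}" using CK Delta3_subsets(1) by (force simp: B_def)
    ultimately show ?thesis using that[of low B f] by blast
  next
    case 2
    define B where "B = {a \<in> {0..3}. {0..3} - {a} \<in> C}"
    have co: "\<exists>a\<in>{0..3}. \<tau> = {0..3} - {a}" if "\<tau> \<in> C" "card \<tau> = 3" for \<tau>
    proof -
      have s: "\<tau> \<subseteq> {0..3}" using that CK Delta3_subsets(1) by blast
      then have "card ({0..3} - \<tau>) = 1" using that(2) finite_subset[OF s] by (simp add: card_Diff_subset)
      then obtain a where "{0..3} - \<tau> = {a}" by (auto simp: card_1_singleton_iff)
      then show ?thesis using s by blast
    qed
    have B: "\<exists>b. b \<in> B \<and> b \<noteq> a \<and> high a b \<in> W" if a: "a \<in> B" for a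
    proof -
      let ?t = "{0..3} - {a}"
      have t: "?t \<in> C" "a \<in> {0..3}" "card ?t = 3" using a by (auto simp: B_def)
      obtain \<sigma> where \<sigma>: "\<sigma> \<in> C" "(\<sigma>, ?t) \<in> W" using down[OF t(1)] t(3) 2 by auto
      have c\<sigma>: "card \<sigma> = 2" "\<sigma> \<subset> ?t" using hasse_edgesD(3,4)[of \<sigma> ?t Delta3] subsetD[OF WH \<sigma>(2)] t(3) by simp_all
      obtain \<tau> where \<tau>: "\<tau> \<in> C" "(\<sigma>, \<tau>) \<in> hasse_edges Delta3 - W" using up[OF \<sigma>(1)] c\<sigma> 2 by auto
      have c\<tau>: "card \<tau> = 3" "\<sigma> \<subset> \<tau>" using hasse_edgesD(3,4)[of \<sigma> \<tau> Delta3] \<tau>(2) c\<sigma>(1) by simp_all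
      obtain b where b: "b \<in> {0..3}" "\<tau> = {0..3} - {b}" using co[OF \<tau>(1) c\<tau>(1)] by blast
      have ba: "b \<noteq> a" using \<tau>(2) \<sigma>(2) b by auto
      have "\<sigma> \<subseteq> {0..3} - {a, b}" using c\<sigma>(2) c\<tau>(2) b by blast
      moreover have "card ({0..3} - {a, b}) = 2" using ba b(1) t(2) by (simp add: card_Diff_subset)
      ultimately have "\<sigma> = {0..3} - {a, b}" using c\<sigma>(1) by (intro card_subset_eq) auto
      then have "high a b \<in> W" using \<sigma>(2) by (simp add: high_def)
      moreover have "b \<in> B" using b \<tau>(1) by (simp add: B_def)
      ultimately show ?thesis using ba by blast
    qed
    then obtain f where "\<And>a. a \<in> B \<Longrightarrow> f a \<in> B \<and> f a \<noteq> a \<and> high a (f a) \<in> W" by metis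
    moreover have "B \<noteq> {}" using co[OF \<tau>0(1)] \<tau>0 2 by (auto simp: B_def)
    moreover have "B \<subseteq> {0..3}" by (auto simp: B_def)
    ultimately show ?thesis using that[of high B f] by blast
  next
    case 3
    have full: "\<tau> = {0..3}" if "\<tau> \<in> C" "card \<tau> = 4" for \<tau>
      using that CK Delta3_subsets(1) by (intro card_subset_eq) auto
    obtain \<sigma> where \<sigma>: "\<sigma> \<in> C" "(\<sigma>, \<tau>0) \<in> W" using down[OF \<tau>0] by blast
    have c: "card \<sigma> = 3" using hasse_edgesD(4)[OF subsetD[OF WH \<sigma>(2)]] \<tau>0(2) 3 by simp
    obtain \<tau> where \<tau>: "\<tau> \<in> C" "(\<sigma>, \<tau>) \<in> hasse_edges Delta3 - W" using up[OF \<sigma>(1)] c 3 by auto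
    have "card \<tau> = 4" using hasse_edgesD(4)[of \<sigma> \<tau> Delta3] \<tau>(2) c by simp
    then have "\<tau> = \<tau>0" using full[OF \<tau>(1)] full[OF \<tau>0(1)] \<tau>0(2) 3 by simp
    then show ?thesis using \<tau>(2) \<sigma>(2) by blast
  qed
qed

section \<open>The matching tree\<close>

text \<open>The masks recur at many nodes of the tree; with tables, checking the tree is rewriting
  with numerals.\<close>

lemma compatible_table:
  "compatible 0 = 268435248" "compatible 1 = 268429048" "compatible 2 = 266797048"
  "compatible 3 = 268435206" "compatible 4 = 268410311" "compatible 5 = 262012871"
  "compatible 6 = 268392246" "compatible 7 = 257425206" "compatible 8 = 268427517"
  "compatible 9 = 268409071" "compatible 10 = 217839871" "compatible 11 = 268388029"
  "compatible 12 = 183494397" "compatible 13 = 268375471" "compatible 14 = 96443887"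
  "compatible 15 = 58677183" "compatible 16 = 266403835" "compatible 17 = 261685215"
  "compatible 18 = 217644031" "compatible 19 = 256311163" "compatible 20 = 182906875"
  "compatible 21 = 253099871" "compatible 22 = 94224351" "compatible 23 = 56065919"
  "compatible 24 = 149679103" "compatible 25 = 79412223" "compatible 26 = 40857599"
  "compatible 27 = 20922367"
  by (simp_all add: compatible_def shares_def edges_def mask_of_def upt_rec)

lemma closing_table:
  "closing 0 = [272, 65568, 66576, 262432]" "closing 1 = [520, 66560, 66080, 132104]"
  "closing 2 = [131080, 262400, 131344, 262664]" "closing 3 = [514, 131076, 132098, 262660]"
  "closing 4 = [257, 132096, 66561, 131332]" "closing 5 = [65537, 262656, 66050, 262401]"
  "closing 6 = [2113536, 528384, 35655680, 17317888]"
  "closing 7 = [4202496, 1050624, 34611200, 20973568]" "closing 8 = [17, 262148, 131092, 262177]"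
  "closing 9 = [10, 262176, 65570, 262156]" "closing 10 = [65538, 131088, 65553, 131082]"
  "closing 11 = [16793600, 1048704, 20971648, 3162112]"
  "closing 12 = [33562624, 524352, 4726784, 35651648]"
  "closing 13 = [33558528, 4194432, 34603136, 4722688]"
  "closing 14 = [16779264, 2097216, 3147776, 17301568]" "closing 15 = []"
  "closing 16 = [33, 1026, 1041, 546]" "closing 17 = [12, 1040, 1034, 276]"
  "closing 18 = [260, 544, 289, 524]" "closing 19 = [20971520, 4160, 4206592, 16793664]"
  "closing 20 = [35651584, 2176, 33562752, 2115584]"
  "closing 21 = [34603008, 16448, 1067008, 33558592]"
  "closing 22 = [17301504, 8320, 536576, 16779392]" "closing 23 = []"
  "closing 24 = [4718592, 18432, 4196480, 540736]"
  "closing 25 = [3145728, 12288, 1056896, 2101312]" "closing 26 = []" "closing 27 = []"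
  by (simp_all add: closing_def cycles_eq mask_of_def)

lemma cycle_masks_eq: "cycle_masks =
  [273, 522, 65569, 66562, 131084, 132112, 262404, 262688, 66577, 66082, 132106, 131348, 262433,
  262668, 36700160, 21495808, 33566720, 4202624, 16795648, 1050752, 2113600, 528448, 34611328,
  4730880, 20973696, 3164160, 35655744, 17317952]"
  by (simp add: cycle_masks_def cycles_eq mask_of_def)

text \<open>Found by a computer search: at every branching the reduced Euler characteristics of the two
  subfamilies add up without cancellation, so no superfluous critical faces arise.\<close>
definition morse_mtree :: matching_tree where
  "morse_mtree =
    Branch 25 (Branch 19 (Branch 12 (Excluded 6 (Excluded 13 (Cone 15))) (Branch 15 (Branch 5
    (Branch 1 (Cone 9) (Cone 0)) (Cone 17)) (Cone 26))) (Branch 13 (Excluded 12 (Branch 20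
    (Excluded 7 (Excluded 21 (Cone 23))) (Branch 23 (Branch 1 (Branch 5 (Cone 16) (Cone 3)) (Cone
    8)) (Cone 26)))) (Branch 3 (Branch 1 (Excluded 9 (Branch 26 (Branch 17 Critical (Cone 16))
    (Branch 23 (Branch 16 Critical (Cone 17)) (Cone 15)))) (Branch 8 (Branch 23 (Branch 2 (Excluded
    17 Critical) (Branch 16 Critical (Cone 17))) (Branch 26 (Branch 17 (Excluded 2 Critical) (Cone
    21)) (Cone 15))) (Cone 9))) (Branch 21 (Excluded 20 (Branch 12 (Excluded 6 (Cone 15)) (Branch
    15 (Branch 2 (Branch 9 Critical (Cone 4)) (Cone 16)) (Cone 26)))) (Branch 11 (Branch 4 (Branch
    16 (Branch 7 (Cone 26) (Cone 0)) (Cone 17)) (Cone 9)) (Branch 0 (Branch 8 (Excluded 4 (Branch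
    16 (Excluded 5 (Branch 26 Critical (Branch 23 Critical (Cone 15)))) (Branch 26 (Branch 5
    Critical (Cone 17)) (Cone 20)))) (Branch 4 (Branch 16 (Branch 26 Critical (Cone 12)) (Cone 17))
    (Cone 9))) (Branch 20 (Branch 5 (Branch 8 (Branch 7 (Cone 15) (Branch 15 Critical (Cone 6)))
    (Cone 1)) (Cone 17)) (Branch 1 (Branch 23 (Cone 6) (Branch 6 (Cone 26) (Cone 7))) (Branch 23
    (Cone 6) (Branch 6 (Branch 12 (Branch 4 (Branch 16 Critical (Cone 2)) (Cone 9)) (Cone 26))
    (Cone 7))))))))))) (Branch 26 (Branch 9 (Branch 1 (Excluded 3 (Branch 7 (Branch 5 (Excluded 16
    (Excluded 18 Critical)) (Branch 17 Critical (Cone 22))) (Cone 6))) (Branch 6 (Branch 16 (Branch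
    5 Critical (Branch 22 Critical (Cone 21))) (Branch 19 (Branch 5 (Excluded 18 Critical) (Branch
    17 Critical (Cone 18))) (Cone 2))) (Cone 11))) (Branch 17 (Branch 2 (Excluded 3 (Branch 6
    (Branch 4 (Excluded 8 (Excluded 10 Critical)) (Cone 14)) (Cone 7))) (Branch 7 (Branch 4
    (Excluded 10 (Branch 1 Critical (Branch 8 Critical (Cone 11)))) (Branch 8 (Branch 14 Critical
    (Cone 13)) (Cone 10))) (Cone 19))) (Branch 0 (Branch 4 (Excluded 8 (Cone 11)) (Branch 16
    (Excluded 5 (Branch 8 (Branch 22 (Cone 13) (Cone 21)) (Cone 10))) (Branch 21 (Branch 10 (Branch
    13 Critical (Cone 14)) (Cone 18)) (Cone 19)))) (Branch 21 (Branch 6 (Excluded 14 (Cone 4))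
    (Branch 4 (Branch 1 (Branch 10 (Excluded 16 Critical) (Branch 16 Critical (Cone 18))) (Branch 8
    (Branch 2 (Excluded 18 Critical) (Branch 16 Critical (Cone 18))) (Cone 11))) (Cone 3))) (Branch
    13 (Branch 7 (Excluded 22 (Cone 5)) (Branch 5 (Branch 2 (Branch 8 (Excluded 18 Critical)
    (Branch 10 Critical (Cone 18))) (Branch 16 (Branch 1 (Excluded 10 Critical) (Branch 8 Critical
    (Cone 10))) (Cone 19))) (Cone 3))) (Branch 3 (Branch 22 (Branch 8 (Branch 2 (Excluded 18
    Critical) (Branch 16 Critical (Cone 18))) (Branch 1 (Branch 16 (Excluded 10 Critical) (Cone
    19)) (Cone 11))) (Cone 14)) (Branch 8 (Branch 7 (Branch 4 (Cone 22) (Branch 22 (Branch 2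
    (Excluded 18 Critical) (Branch 16 Critical (Cone 18))) (Cone 5))) (Cone 6)) (Branch 16 (Branch
    1 (Excluded 10 (Branch 4 (Cone 22) (Branch 22 (Branch 7 Critical (Cone 6)) (Cone 5)))) (Cone
    10)) (Branch 4 (Cone 22) (Branch 22 (Branch 10 (Branch 1 (Branch 7 Critical (Cone 19)) (Branch
    19 (Branch 11 Critical (Cone 6)) (Cone 2))) (Cone 18)) (Cone 5))))))))))) (Branch 19 (Branch 11
    (Branch 3 (Branch 22 (Excluded 24 (Branch 10 Critical (Cone 9))) (Branch 18 (Branch 14 Critical
    (Cone 9)) (Cone 17))) (Cone 0)) (Branch 22 (Excluded 24 (Branch 10 (Branch 6 (Excluded 12 (Cone
    1)) (Branch 13 (Excluded 12 (Branch 0 Critical (Cone 1))) (Cone 15))) (Cone 18))) (Branch 4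
    (Branch 15 (Branch 8 (Excluded 0 (Branch 18 Critical (Cone 17))) (Branch 1 (Branch 10 (Excluded
    17 Critical) (Branch 18 Critical (Cone 17))) (Cone 0))) (Cone 27)) (Branch 6 (Excluded 12
    (Branch 8 (Branch 17 (Branch 14 (Excluded 24 Critical) (Cone 24)) (Cone 5)) (Cone 1))) (Branch
    9 (Branch 1 (Excluded 3 (Branch 18 (Excluded 5 (Branch 27 Critical (Cone 15))) (Cone 24)))
    (Branch 5 (Excluded 18 (Cone 0)) (Branch 18 (Cone 12) (Cone 17)))) (Branch 1 (Branch 14 (Cone
    15) (Branch 15 (Branch 18 (Branch 3 Critical (Cone 5)) (Branch 10 (Branch 3 (Excluded 17
    Critical) (Branch 5 Critical (Cone 17))) (Cone 24))) (Cone 13))) (Branch 18 (Branch 8 (Branch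
    14 (Cone 15) (Branch 15 (Branch 0 (Excluded 5 Critical) (Branch 3 Critical (Cone 5))) (Cone
    13))) (Cone 12)) (Branch 3 (Cone 17) (Cone 0))))))))) (Branch 11 (Branch 14 (Excluded 24
    (Branch 18 (Branch 7 (Excluded 20 (Cone 2)) (Branch 21 (Excluded 20 (Branch 0 Critical (Cone
    2))) (Cone 23))) (Cone 10))) (Branch 5 (Branch 23 (Branch 16 (Excluded 0 (Branch 10 Critical
    (Cone 9))) (Branch 2 (Branch 10 Critical (Branch 18 (Excluded 9 Critical) (Cone 9))) (Cone 0)))
    (Cone 27)) (Branch 7 (Excluded 20 (Branch 16 (Branch 9 (Branch 22 (Excluded 24 Critical) (Cone
    24)) (Cone 4)) (Cone 2))) (Branch 17 (Branch 2 (Excluded 3 (Branch 10 (Excluded 4 (Branch 27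
    Critical (Cone 23))) (Cone 24))) (Branch 4 (Excluded 10 (Cone 0)) (Branch 10 (Cone 20) (Cone
    9)))) (Branch 2 (Branch 22 (Cone 23) (Branch 23 (Branch 10 (Branch 3 Critical (Cone 4)) (Branch
    18 (Branch 3 (Excluded 9 Critical) (Branch 4 Critical (Cone 9))) (Cone 24))) (Cone 21)))
    (Branch 10 (Branch 16 (Branch 22 (Cone 23) (Branch 23 (Branch 0 (Excluded 4 Critical) (Branch 3
    Critical (Cone 4))) (Cone 21))) (Cone 20)) (Branch 3 (Cone 9) (Cone 0)))))))) (Branch 0 (Branch
    9 (Branch 24 (Branch 5 (Excluded 16 (Branch 27 Critical (Branch 23 Critical (Cone 15))))
    (Branch 17 (Branch 27 Critical (Branch 23 Critical (Cone 15))) (Cone 16))) (Branch 20 (Branch 5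
    (Excluded 18 (Branch 27 Critical (Branch 23 Critical (Cone 15)))) (Branch 17 (Branch 27
    Critical (Branch 23 Critical (Cone 15))) (Cone 18))) (Cone 12))) (Branch 17 (Branch 24 (Branch
    4 (Excluded 8 (Branch 27 Critical (Branch 23 Critical (Cone 15)))) (Cone 8)) (Branch 12 (Branch
    4 (Excluded 10 (Branch 27 Critical (Branch 23 Critical (Cone 15)))) (Cone 10)) (Cone 20)))
    (Branch 24 (Branch 4 (Excluded 8 (Cone 16)) (Cone 8)) (Branch 4 (Excluded 8 (Branch 27 (Cone
    21) (Branch 21 (Cone 15) (Cone 22)))) (Branch 22 (Branch 15 (Branch 8 (Branch 16 Critical (Cone
    18)) (Branch 18 (Branch 20 Critical (Cone 12)) (Cone 10))) (Cone 13)) (Branch 27 (Cone 13)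
    (Branch 13 (Branch 21 (Branch 8 (Branch 16 Critical (Cone 18)) (Branch 18 (Branch 20 Critical
    (Cone 12)) (Cone 10))) (Cone 23)) (Cone 14)))))))) (Branch 9 (Branch 17 (Branch 20 (Branch 3
    (Excluded 1 (Branch 27 Critical (Branch 23 Critical (Cone 15)))) (Cone 1)) (Branch 12 (Branch 3
    (Excluded 2 (Branch 27 Critical (Branch 23 Critical (Cone 15)))) (Cone 2)) (Cone 24))) (Branch
    20 (Branch 3 (Excluded 1 (Cone 18)) (Cone 1)) (Branch 3 (Excluded 1 (Branch 27 (Cone 21)
    (Branch 21 (Cone 15) (Cone 22)))) (Branch 21 (Branch 15 (Branch 1 (Branch 18 Critical (Cone
    16)) (Branch 16 (Branch 24 Critical (Cone 12)) (Cone 2))) (Cone 6)) (Branch 23 (Cone 6) (Branch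
    6 (Branch 22 (Branch 1 (Branch 18 Critical (Cone 16)) (Branch 16 (Branch 24 Critical (Cone 12))
    (Cone 2))) (Cone 27)) (Cone 7))))))) (Branch 17 (Branch 12 (Branch 3 (Excluded 2 (Cone 10))
    (Cone 2)) (Branch 3 (Excluded 2 (Branch 27 (Cone 13) (Branch 13 (Cone 23) (Cone 14)))) (Branch
    13 (Branch 23 (Branch 1 (Branch 24 Critical (Cone 10)) (Branch 10 (Branch 2 Critical (Cone 20))
    (Cone 8))) (Cone 7)) (Branch 23 (Cone 6) (Branch 6 (Branch 14 (Branch 1 (Branch 24 Critical
    (Cone 10)) (Branch 10 (Branch 2 Critical (Cone 20)) (Cone 8))) (Cone 27)) (Cone 7)))))) (Branch
    22 (Branch 7 (Excluded 13 (Cone 4)) (Branch 15 (Branch 24 (Branch 1 (Cone 16) (Cone 8)) (Branch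
    3 (Branch 8 (Branch 2 (Excluded 18 Critical) (Branch 16 Critical (Cone 18))) (Branch 20 (Cone
    1) (Branch 1 (Branch 10 (Excluded 16 Critical) (Branch 16 Critical (Cone 18))) (Cone 12))))
    (Cone 4))) (Cone 23))) (Branch 4 (Branch 23 (Cone 6) (Branch 24 (Branch 1 (Cone 16) (Cone 8))
    (Branch 7 (Branch 27 (Branch 8 (Branch 2 (Excluded 18 Critical) (Branch 16 Critical (Cone 18)))
    (Branch 20 (Cone 1) (Branch 1 (Branch 10 (Excluded 16 Critical) (Branch 16 Critical (Cone 18)))
    (Cone 12)))) (Cone 15)) (Cone 21)))) (Branch 6 (Branch 21 (Excluded 14 (Cone 27)) (Cone 5))
    (Branch 24 (Branch 23 (Branch 1 (Cone 16) (Cone 8)) (Branch 1 (Cone 16) (Cone 8))) (Branch 8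
    (Branch 21 (Cone 3) (Branch 3 (Branch 27 (Cone 13) (Branch 13 (Cone 23) (Cone 14))) (Cone 5)))
    (Branch 16 (Branch 21 (Cone 3) (Branch 3 (Branch 27 (Cone 13) (Branch 13 (Cone 23) (Cone 14)))
    (Cone 5))) (Branch 21 (Cone 3) (Branch 3 (Branch 27 (Cone 13) (Branch 13 (Cone 23) (Cone 14)))
    (Cone 5)))))))))))))))"

lemma num_critical_morse_mtree: "num_critical morse_mtree = 99"
  by (simp add: morse_mtree_def)

lemma certifies_morse_mtree: "certifies morse_mtree 0 (2 ^ 28 - 1) 0"
  unfolding morse_mtree_def
  \<comment> \<open>The simplifier turns the vertex 1 into \<open>Suc 0\<close>, so the tables are
    supplied in that form as well.\<close>
  by (simp add: compatible_table closing_table cycle_masks_eq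
      compatible_table[unfolded One_nat_def] closing_table[unfolded One_nat_def] bit_Suc_0_iff)

section \<open>The Morse complex of the 3-simplex\<close>

lemma bits_subset: "m < 2 ^ k \<Longrightarrow> bits m \<subseteq> {..<k}"
proof
  fix i assume m: "m < 2 ^ k" and "i \<in> bits m"
  then have i: "bit m i" by (simp add: bits_def)
  show "i \<in> {..<k}"
  proof (rule ccontr)
    assume "i \<notin> {..<k}"
    then have "2 ^ k \<le> (2 ^ i :: nat)" by simp
    then have "m < 2 ^ i" using m by linarith
    then show False using i by (simp add: bit_iff_odd)
  qed
qed

definition hedge :: "nat \<Rightarrow> nat set \<times> nat set" where
  "hedge i = (bits (fst (edges ! i)), bits (snd (edges ! i)))"

lemma distinct_edges: "distinct edges" and length_edges: "length edges = 28"
  by (simp_all add: edges_def)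

lemma hedge_eq_iff: "i < 28 \<Longrightarrow> j < 28 \<Longrightarrow> hedge i = hedge j \<longleftrightarrow> i = j"
  using nth_eq_iff_index_eq[OF distinct_edges, of i j] length_edges
  by (auto simp: hedge_def bits_eq_iff prod_eq_iff)

lemma inj_on_hedge: "inj_on hedge {..<28}"
  by (rule inj_onI) (simp add: hedge_eq_iff)

lemma hedge_disjoint_iff:
  "{fst (hedge i), snd (hedge i)} \<inter> {fst (hedge j), snd (hedge j)} = {} \<longleftrightarrow> \<not> shares i j"
  by (auto simp: hedge_def bits_eq_iff shares_def)

text \<open>In terms of masks, going up one dimension means setting one bit, so that
  \<open>edges\<close> is the full Hasse diagram becomes a finite check in each direction.\<close>

lemma edges_sound: "\<forall>(s, t)\<in>set edges. s < 16 \<and> t < 16 \<and> s \<noteq> 0 \<and> (\<exists>x\<in>set [0..<4]. \<not> bit s x \<and> t = or s (2 ^ x))"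
  by (simp add: edges_def upt_rec bit_Suc_0_iff)

lemma edges_complete: "\<forall>s\<in>{1, 2, 3, 4, 5, 6, 7, 8, 9, 10, 11, 12, 13, 14, 15}. \<forall>x\<in>{0, 1, 2, 3}. \<not> bit s x \<longrightarrow> (s, or s (2 ^ x)) \<in> set edges"
  by (simp add: edges_def bit_Suc_0_iff)

lemma bits_or_exp: "bits (or s (2 ^ x)) = insert x (bits s)"
  by (simp add: bits_simps)

lemma finite_bits: "m < 2 ^ k \<Longrightarrow> finite (bits m)"
  using bits_subset finite_subset by blast

lemma bits_in_Delta3: "s < 16 \<Longrightarrow> s \<noteq> 0 \<Longrightarrow> bits s \<in> Delta3"
proof -
  assume s: "s < 16" "s \<noteq> 0"
  have "bits s \<subseteq> {..<4}" by (rule bits_subset) (use s in simp)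
  also have "{..<4} = {0..3::nat}" by auto
  finally have "bits s \<subseteq> {0..3}" .
  moreover have "bits s \<noteq> {}" using s(2) bits_eq_iff[of s 0] by (simp add: bits_simps)
  ultimately show ?thesis by (simp add: Delta3_def)
qed

lemma Delta3_eq_bits: "\<sigma> \<in> Delta3 \<Longrightarrow> \<exists>s. 0 < s \<and> s < 16 \<and> \<sigma> = bits s"
proof -
  assume \<sigma>: "\<sigma> \<in> Delta3"
  define s where "s = mask_of (filter (\<lambda>i. i \<in> \<sigma>) [0..<4])"
  have bs: "bits s = \<sigma>" using Delta3_subsets(1)[OF \<sigma>] by (auto simp: s_def bits_mask_of)
  have "bit s i \<Longrightarrow> i < 4" for i using Delta3_subsets(1)[OF \<sigma>] bs by (force simp: bits_def)
  then have "take_bit 4 s = s" by (intro bit_eqI) (auto simp: bit_take_bit_iff)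
  then have "s < 16" using take_bit_nat_less_exp[of 4 s] by simp
  moreover have "s \<noteq> 0" using bs Delta3_subsets(3)[OF \<sigma>] by (auto simp: bits_simps)
  ultimately show ?thesis using bs by blast
qed

lemma hedge_image: "hedge ` {..<28} = hasse_edges Delta3"
proof
  show "hedge ` {..<28} \<subseteq> hasse_edges Delta3"
  proof
    fix p assume "p \<in> hedge ` {..<28}"
    then obtain i where i: "i < 28" "p = hedge i" by blast
    obtain s t where st: "edges ! i = (s, t)" by fastforce
    then have "(s, t) \<in> set edges" using i length_edges by (metis nth_mem)
    then obtain x where x: "s < 16" "t < 16" "s \<noteq> 0" "\<not> bit s x" "t = or s (2 ^ x)"
      using bspec[OF edges_sound] by fastforce
    have t: "bits t = insert x (bits s)" "x \<notin> bits s" unfolding x(5) by (rule bits_or_exp) (use x(4) in \<open>simp add: bits_def\<close>)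
    have "t \<noteq> 0" using t(1) bits_simps(3) by (metis insert_not_empty)
    then have "bits s \<in> Delta3" "bits t \<in> Delta3" using bits_in_Delta3 x(1-3) by blast+
    moreover have "bits s \<subset> bits t" "card (bits t) = Suc (card (bits s))"
      using t finite_bits[of s 4] x(1) by auto
    ultimately show "p \<in> hasse_edges Delta3" by (simp add: i(2) hedge_def st hasse_edges_def)
  qed
  show "hasse_edges Delta3 \<subseteq> hedge ` {..<28}"
  proof
    fix p assume p: "p \<in> hasse_edges Delta3"
    obtain \<sigma> \<tau> where p': "p = (\<sigma>, \<tau>)" by fastforce
    note h = hasse_edgesD[OF p[unfolded p']]
    have "card (\<tau> - \<sigma>) = 1"
      using h(3,4) Delta3_subsets(2)[OF h(1)] by (simp add: card_Diff_subset psubset_imp_subset)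
    then obtain x where "\<tau> - \<sigma> = {x}" by (auto simp: card_1_singleton_iff)
    then have x: "\<tau> = insert x \<sigma>" "x \<notin> \<sigma>" "x \<in> {0..3}" using h(3) Delta3_subsets(1)[OF h(2)] by auto
    obtain s where s: "0 < s" "s < 16" "\<sigma> = bits s" using Delta3_eq_bits[OF h(1)] by blast
    have "s \<in> {1, 2, 3, 4, 5, 6, 7, 8, 9, 10, 11, 12, 13, 14, 15}" using s(1,2) by (simp; presburger)
    moreover have "x \<in> {0, 1, 2, 3}" using x(3) by (simp; presburger)
    moreover have "\<not> bit s x" using s(3) x(2) by (simp add: bits_def)
    ultimately have "(s, or s (2 ^ x)) \<in> set edges" using edges_complete by blast
    then obtain i where "i < 28" "edges ! i = (s, or s (2 ^ x))"
      using length_edges by (metis in_set_conv_nth)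
    then have "hedge i = p" "i < 28" using p' x(1) s(3) by (simp_all add: hedge_def bits_or_exp)
    then show "p \<in> hedge ` {..<28}" by blast
  qed
qed

lemma is_matching_hedge_iff:
  assumes W: "W \<subseteq> {..<28}"
  shows "is_matching Delta3 (hedge ` W) \<longleftrightarrow> (\<forall>i\<in>W. \<forall>j\<in>W. i \<noteq> j \<longrightarrow> \<not> shares i j)"
proof
  assume M: "is_matching Delta3 (hedge ` W)"
  show "\<forall>i\<in>W. \<forall>j\<in>W. i \<noteq> j \<longrightarrow> \<not> shares i j"
  proof (intro ballI impI)
    fix i j assume ij: "i \<in> W" "j \<in> W" "i \<noteq> j"
    then have "hedge i \<noteq> hedge j" using W hedge_eq_iff[of i j] by auto
    then have "{fst (hedge i), snd (hedge i)} \<inter> {fst (hedge j), snd (hedge j)} = {}"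
      using M ij unfolding is_matching_def by blast
    then show "\<not> shares i j" by (simp only: hedge_disjoint_iff simp_thms)
  qed
next
  assume sh: "\<forall>i\<in>W. \<forall>j\<in>W. i \<noteq> j \<longrightarrow> \<not> shares i j"
  show "is_matching Delta3 (hedge ` W)"
    unfolding is_matching_def
  proof (intro conjI ballI impI)
    show "hedge ` W \<subseteq> hasse_edges Delta3" using W hedge_image by blast
    fix e e' assume "e \<in> hedge ` W" "e' \<in> hedge ` W" "e \<noteq> e'"
    then obtain i j where "i \<in> W" "j \<in> W" and ij: "e = hedge i" "e' = hedge j" by blast
    with \<open>e \<noteq> e'\<close> sh have "\<not> shares i j" by metis
    show "{fst e, snd e} \<inter> {fst e', snd e'} = {}"
      unfolding ij hedge_disjoint_iff by fact
  qed
qed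

lemma vertices_eq: "{0..3} = {0, 1, 2, 3::nat}"
  by auto

lemma low_index_edges: "\<forall>a\<in>{0..3}. \<forall>b\<in>{0..3}. a \<noteq> b \<longrightarrow>
    low_index a b < 28 \<and> edges ! low_index a b = (2 ^ a, or (2 ^ a) (2 ^ b))"
  unfolding vertices_eq by (simp add: low_index_def edges_def)

lemma high_index_edges: "\<forall>a\<in>{0..3}. \<forall>b\<in>{0..3}. a \<noteq> b \<longrightarrow>
    high_index a b < 28 \<and> edges ! high_index a b = (xor (xor 15 (2 ^ a)) (2 ^ b), xor 15 (2 ^ a))"
  unfolding vertices_eq by (simp add: high_index_def edges_def)

lemma bits_mask: "bits (2 ^ n - 1) = {..<n}"
  unfolding mask_eq_exp_minus_1[symmetric] by (auto simp: bits_def bit_mask_iff)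

lemma low_index:
  assumes "a \<in> {0..3}" "b \<in> {0..3}" "a \<noteq> b"
  shows "low_index a b < 28 \<and> hedge (low_index a b) = low a b"
proof -
  have "low_index a b < 28" "edges ! low_index a b = (2 ^ a, or (2 ^ a) (2 ^ b))"
    using low_index_edges assms by blast+
  then show ?thesis by (simp add: hedge_def low_def bits_simps insert_commute)
qed

lemma high_index:
  assumes "a \<in> {0..3}" "b \<in> {0..3}" "a \<noteq> b"
  shows "high_index a b < 28 \<and> hedge (high_index a b) = high a b"
proof -
  have h: "high_index a b < 28"
    "edges ! high_index a b = (xor (xor 15 (2 ^ a)) (2 ^ b), xor 15 (2 ^ a))"
    using high_index_edges assms by blast+
  have "bits (2 ^ 4 - 1) = {0..3}" unfolding bits_mask by auto
  then have 15: "bits 15 = {0..3}" by simp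
  have "bit (15::nat) a" using assms(1) unfolding 15[symmetric] by (simp only: bits_def mem_Collect_eq)
  then have a: "bits (xor 15 (2 ^ a)) = {0..3} - {a}" using bits_xor 15 by simp
  have "b \<in> {0..3} - {a}" using assms by simp
  then have "bit (xor (15::nat) (2 ^ a)) b" unfolding a[symmetric] by (simp only: bits_def mem_Collect_eq)
  then have "bits (xor (xor 15 (2 ^ a)) (2 ^ b)) = {0..3} - {a} - {b}" using bits_xor a by simp
  then have "bits (xor (xor 15 (2 ^ a)) (2 ^ b)) = {0..3} - {a, b}" by blast
  then show ?thesis using h a by (simp add: hedge_def high_def)
qed

text \<open>A directed cycle yields a fixed point free self-map of some vertices. A cycle of length
  3 or 4 of this map gives a member of \<open>cycles\<close> inside \<open>W\<close>; one of length
  2 gives two matched edges that share a simplex.\<close>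

lemma good_imp_acyclic:
  assumes good: "good W"
  shows "acyclic_matching Delta3 (hedge ` W)"
proof (rule ccontr)
  assume nac: "\<not> ?thesis"
  have W: "W \<subseteq> {..<28}" and cyc: "\<And>l. l \<in> set cycles \<Longrightarrow> \<not> set l \<subseteq> W"
    using good by (auto simp: good_def)
  have M: "is_matching Delta3 (hedge ` W)" using good is_matching_hedge_iff[OF W] by (simp add: good_def)
  then have "\<not> acyclic ((hasse_edges Delta3 - hedge ` W) \<union> (hedge ` W)\<inverse>)"
    using nac by (simp add: acyclic_matching_def)
  then obtain C f l where l: "l \<in> {low, high}" and C: "C \<subseteq> {0..3}" "C \<noteq> {}"
    and f: "\<And>a. a \<in> C \<Longrightarrow> f a \<in> C \<and> f a \<noteq> a \<and> l a (f a) \<in> hedge ` W"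
    using cyclic_matching_Delta3[OF M] by (metis (no_types, lifting))
  obtain ix where ix: "ix \<in> {low_index, high_index}"
    and hix: "\<And>a b. a \<in> {0..3} \<Longrightarrow> b \<in> {0..3} \<Longrightarrow> a \<noteq> b \<Longrightarrow> ix a b < 28 \<and> hedge (ix a b) = l a b"
  proof -
    from l consider "l = low" | "l = high" by blast
    then show thesis
      by cases (use that[of low_index] that[of high_index] low_index high_index in simp_all)
  qed
  have ixW: "ix a (f a) \<in> W" if a: "a \<in> C" for a
  proof -
    have "a \<in> {0..3}" "f a \<in> {0..3}" "a \<noteq> f a" using a f[OF a] C(1) by auto
    then have "ix a (f a) < 28" "hedge (ix a (f a)) \<in> hedge ` W" using hix f[OF a] by simp_all
    then show ?thesis using W inj_on_image_mem_iff[OF inj_on_hedge] by simp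
  qed
  \<comment> \<open>Assuming that no point has period 2 leads to a contradiction, because triangles
    and squares are ruled out by \<open>cyc\<close>; hence such a point exists.\<close>
  from C have "\<exists>a\<in>C. f (f a) = a" "False" if "\<And>a. a \<in> C \<Longrightarrow> f (f a) \<noteq> a"
  proof -
    have ff: "\<And>a. a \<in> C \<Longrightarrow> f a \<in> C \<and> f a \<noteq> a" using f by blast
    show False
      using C ff
    proof (rule self_map_has_short_cycle)
      fix a assume "a \<in> C" "f (f a) = a"
      then show False using that by blast
    next
      fix a b c assume abc: "a \<in> C" "b \<in> C" "c \<in> C" "distinct [a, b, c]" "f a = b" "f b = c" "f c = a"
      have "ix a b \<in> W" "ix b c \<in> W" "ix c a \<in> W"
        using ixW[OF abc(1)] ixW[OF abc(2)] ixW[OF abc(3)] unfolding abc(5-7) .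
      moreover have "\<exists>l\<in>set cycles. set l \<subseteq> {ix a b, ix b c, ix c a}"
        using triangle_in_cycles[OF ix, of a b c] abc(1-4) subsetD[OF C(1)] by simp
      ultimately show False using cyc by blast
    next
      fix a b c e assume abc: "a \<in> C" "b \<in> C" "c \<in> C" "e \<in> C" "distinct [a, b, c, e]"
        "f a = b" "f b = c" "f c = e" "f e = a"
      have "ix a b \<in> W" "ix b c \<in> W" "ix c e \<in> W" "ix e a \<in> W"
        using ixW[OF abc(1)] ixW[OF abc(2)] ixW[OF abc(3)] ixW[OF abc(4)] unfolding abc(6-9) .
      moreover have "\<exists>l\<in>set cycles. set l \<subseteq> {ix a b, ix b c, ix c e, ix e a}"
        using square_in_cycles[OF ix, of a b c e] abc(1-5) subsetD[OF C(1)] by simp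
      ultimately show False using cyc by blast
    qed
    then show "\<exists>a\<in>C. f (f a) = a" ..
  qed
  then obtain a where a: "a \<in> C" "f (f a) = a" by blast
  define b where "b = f a"
  have b: "b \<in> C" "b \<noteq> a" "f b = a" using f[OF a(1)] a(2) by (auto simp: b_def)
  have mem: "l a b \<in> hedge ` W" "l b a \<in> hedge ` W" using f[OF a(1)] f[OF b(1)] b(3) by (auto simp: b_def)
  \<comment> \<open>The two matched edges share the simplex {a, b} on the lower level and its
    complement on the upper one, but they are different edges.\<close>
  have "fst (l a b) = fst (l b a) \<or> snd (l a b) = snd (l b a)"
    using l by (auto simp: low_def high_def insert_commute)
  then have "{fst (l a b), snd (l a b)} \<inter> {fst (l b a), snd (l b a)} \<noteq> {}" by auto
  then have "l a b = l b a" using M mem unfolding is_matching_def by blast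
  moreover have "l a b \<noteq> l b a"
  proof -
    have "a \<in> {0..3}" using a(1) C(1) by blast
    then have "a \<in> snd (high b a)" "a \<notin> snd (high a b)" using b(2) by (simp_all add: high_def)
    moreover have "low a b \<noteq> low b a" using b(2) by (simp add: low_def)
    ultimately show ?thesis using l by auto
  qed
  ultimately show False by blast
qed

text \<open>One round of a closed path: from the top of edge \<open>i\<close> down to its bottom
  along the reversed matched edge, then up to the top of edge \<open>j\<close>.\<close>

definition follows :: "nat \<Rightarrow> nat \<Rightarrow> bool" where
  "follows i j \<longleftrightarrow> i < 28 \<and> j < 28 \<and> i \<noteq> j \<and> (fst (edges ! i), snd (edges ! j)) \<in> set edges"

lemma cycles_closed: "\<forall>l\<in>set cycles.
    (\<exists>i j k. l = [i, j, k] \<and> follows i j \<and> follows j k \<and> follows k i) \<or>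
    (\<exists>i j k m. l = [i, j, k, m] \<and> follows i j \<and> follows j k \<and> follows k m \<and> follows m i)"
  unfolding cycles_eq list.set
proof (intro ballI, elim insertE emptyE)
qed (hypsubst, simp, simp add: follows_def edges_def)+

text \<open>Each list in \<open>cycles\<close> is closed under \<open>follows\<close>, so if all its
  members were matched, these rounds would concatenate to a directed cycle.\<close>

lemma acyclic_imp_good:
  assumes W: "W \<subseteq> {..<28}" and ac: "acyclic_matching Delta3 (hedge ` W)"
  shows "good W"
proof -
  let ?R = "(hasse_edges Delta3 - hedge ` W) \<union> (hedge ` W)\<inverse>"
  have M: "is_matching Delta3 (hedge ` W)" and R: "acyclic ?R" using ac by (auto simp: acyclic_matching_def)
  have sh: "\<And>i j. i \<in> W \<Longrightarrow> j \<in> W \<Longrightarrow> i \<noteq> j \<Longrightarrow> \<not> shares i j"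
    using M is_matching_hedge_iff[OF W] by blast
  have path: "(snd (hedge i), snd (hedge j)) \<in> ?R\<^sup>+" if ij: "follows i j" "i \<in> W" "j \<in> W" for i j
  proof -
    have "(snd (hedge i), fst (hedge i)) \<in> ?R" using ij(2) by (metis UnCI converse.intros imageI prod.collapse)
    moreover have "(fst (hedge i), snd (hedge j)) \<in> ?R"
    proof -
      obtain k where k: "k < 28" "edges ! k = (fst (edges ! i), snd (edges ! j))"
        using ij(1) length_edges by (metis follows_def in_set_conv_nth)
      then have hk: "hedge k = (fst (hedge i), snd (hedge j))" by (simp add: hedge_def)
      then have "hedge k \<in> hasse_edges Delta3" using k(1) hedge_image by blast
      \<comment> \<open>The edge used for going up shares its bottom with \<open>i\<close> and its
        top with \<open>j\<close>; in a matching it would have to equal both.\<close>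
      moreover have "k \<notin> W"
      proof
        assume "k \<in> W"
        moreover have "shares k i" "shares k j" using k(2) by (auto simp: shares_def)
        ultimately have "k = i" "k = j" using sh ij by blast+
        then show False using ij(1) by (simp add: follows_def)
      qed
      then have "hedge k \<notin> hedge ` W" using inj_on_image_mem_iff[OF inj_on_hedge] k(1) W by simp
      ultimately show ?thesis using hk by simp
    qed
    ultimately show ?thesis by (rule trancl_into_trancl[OF r_into_trancl])
  qed
  have "\<not> set l \<subseteq> W" if l: "l \<in> set cycles" for l
  proof
    assume lW: "set l \<subseteq> W"
    have "\<exists>i. (snd (hedge i), snd (hedge i)) \<in> ?R\<^sup>+"
      using bspec[OF cycles_closed l]
    proof (elim disjE exE conjE)
      fix i j k assume "l = [i, j, k]" and fo: "follows i j" "follows j k" "follows k i"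
      then have "i \<in> W" "j \<in> W" "k \<in> W" using lW by auto
      then show ?thesis using path[OF fo(1)] path[OF fo(2)] path[OF fo(3)] by (blast intro: trancl_trans)
    next
      fix i j k m assume "l = [i, j, k, m]"
        and fo: "follows i j" "follows j k" "follows k m" "follows m i"
      then have "i \<in> W" "j \<in> W" "k \<in> W" "m \<in> W" using lW by auto
      then show ?thesis using path[OF fo(1)] path[OF fo(2)] path[OF fo(3)] path[OF fo(4)]
        by (blast intro: trancl_trans)
    qed
    then show False using R by (auto simp: acyclic_def)
  qed
  then show ?thesis using W sh unfolding good_def by blast
qed

lemma morse_complex_Delta3: "morse_complex Delta3 = (`) hedge ` {W. W \<noteq> {} \<and> good W}"
proof
  show "morse_complex Delta3 \<subseteq> (`) hedge ` {W. W \<noteq> {} \<and> good W}"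
  proof
    fix X assume X: "X \<in> morse_complex Delta3"
    then have "X \<subseteq> hedge ` {..<28}"
      unfolding hedge_image by (simp add: morse_complex_def acyclic_matching_def is_matching_def)
    then obtain W where W: "W \<subseteq> {..<28}" "X = hedge ` W" by (auto simp: subset_image_iff)
    then have "W \<noteq> {} \<and> good W" using X acyclic_imp_good[OF W(1)] by (auto simp: morse_complex_def)
    then show "X \<in> (`) hedge ` {W. W \<noteq> {} \<and> good W}" using W(2) by blast
  qed
qed (use good_imp_acyclic in \<open>auto simp: morse_complex_def\<close>)

theorem mainTheorem10:
  shows "geom_real (morse_complex Delta3) homotopy_equivalent_space wedge_spheres 99 4"
proof -
  define K where "K = {W. W \<noteq> {} \<and> good W}"
  have fin: "finite W" if "good W" for W using that finite_subset[of W "{..<28}"] by (simp add: good_def)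
  have K: "simplicial_complex K" unfolding simplicial_complex_def K_def using fin good_mono by blast
  have finK: "finite K"
    by (rule finite_subset[of _ "Pow {..<28}"]) (auto simp: K_def good_def)
  have V: "bits (2 ^ 28 - 1) = {..<28}" by (rule bits_mask)
  then have st: "state 0 (2 ^ 28 - 1)" by (simp add: state_def bits_simps(3))
  have "good {}" by (simp add: good_def cycles_eq)
  moreover have "faces 0 (2 ^ 28 - 1) = {W. good W}"
    unfolding faces_def bits_simps(3) V by (auto simp: good_def)
  ultimately have faces: "faces 0 (2 ^ 28 - 1) = insert {} K" by (auto simp: K_def)
  have "card (bits 0) = 0" by (simp add: bits_simps(3))
  note snd = certifies_sound[OF certifies_morse_mtree st this, unfolded faces num_critical_morse_mtree]
  have fr: "branch_once morse_mtree" using snd by blast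
  have pm: "insert u W \<in> insert {} K" if "W \<in> insert {} K" "partner morse_mtree W = Some u" for W u
    using snd that by blast
  have "card W = 5" if "W \<in> insert {} K" "partner morse_mtree W = None" for W
    using snd that by blast
  then have crit: "card W = Suc 4" if "W \<in> insert {} K" "partner morse_mtree W = None" for W
    using that by simp
  have num: "card {W \<in> insert {} K. partner morse_mtree W = None} = 99" using snd by blast
  have pm': "insert u W \<in> K" if "W \<in> insert {} K" "partner morse_mtree W = Some u" for W u
    using pm[OF that] by simp
  define C where "C = {W \<in> K. partner morse_mtree W = None}"
  \<comment> \<open>The empty face has no elements, so it is not critical, and the 99 critical
    members of the family are all simplices.\<close>
  have "partner morse_mtree {} \<noteq> None" using crit[of "{}"] by auto
  then have "{W \<in> insert {} K. partner morse_mtree W = None} = C" by (auto simp: C_def)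
  then have C99: "card C = 99" using num by simp
  obtain K' where K': "simplicial_complex K'" "finite K'" "geom_real K homotopy_equivalent_space geom_real K'"
    "C \<subseteq> K'" "\<forall>W\<in>K'. card W \<le> Suc 4" "contractible_space (geom_real (K' - C))" "K' - C \<noteq> {}"
    using mtree_collapse_to_facets[of morse_mtree K 4, folded C_def] fr K finK pm' crit by blast
  have dim: "card A = Suc 4" if "A \<in> C" for A using that crit by (simp add: C_def)
  have "geom_real K' homotopy_equivalent_space wedge_spheres (card C) 4"
  proof (rule homotopy_equivalent_wedge_of_facets)
    show "B = A" if "A \<in> C" "B \<in> K'" "A \<subseteq> B" for A B
      using card_seteq[of B A] simplicial_complexD(1)[OF K'(1) that(2)] bspec[OF K'(5) that(2)] dim[OF that(1)] that(3) by simp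
    show "C \<noteq> {}" using C99 by auto
  qed (use K' dim in simp_all)
  then have "geom_real K homotopy_equivalent_space wedge_spheres 99 4"
    using K'(3) C99 homotopy_eqv_trans by simp
  moreover have "inj_on hedge (\<Union>K)"
    by (rule inj_on_subset[OF inj_on_hedge]) (auto simp: K_def good_def)
  then have "geom_real K homeomorphic_space geom_real (morse_complex Delta3)"
    using homeomorphic_geom_real_image[OF K] by (simp add: morse_complex_Delta3 K_def)
  ultimately show ?thesis
    using homeomorphic_imp_homotopy_equivalent_space homotopy_equivalent_space_sym homotopy_eqv_trans by blast
qed

end
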